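(* Let $\Bbbk$ be a field of characteristic $0$ and $V$ an $n$-dimensional $\Bbbk$-vector space. For $x\in\mathrm{Leib}(V)$, the Zariski tangent space is naturally isomorphic to the space of Leibniz $2$-cocycles $$T_x\mathrm{Leib}(V)\cong Z^2_{\mathrm{Leib}}(V,V):=\ker(\delta_x:C^2\to C^3).$$ Under the $\mathrm{GL}(V)$-action on $V^{2,1}$, the orbit tangent at $x$ identifies with the $2$-coboundaries $$T_x(\mathrm{GL}(V)\cdot x)\cong B^2_{\mathrm{Leib}}(V,V):=\mathrm{im}(\delta_x:C^1\to C^2),$$ and the tangent of the quotient stack is Leibniz cohomology $$T_{[x]}[\mathrm{Leib}(V)/\mathrm{GL}(V)]\cong H^2_{\mathrm{Leib}}(V,V):=Z^2_{\mathrm{Leib}}(V,V)/B^2_{\mathrm{Leib}}(V,V).$$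
   Context: $V^{2,1}=\mathrm{Hom}(V\otimes V,V)$; each $x\in V^{2,1}$ corresponds to a bilinear product $\mu_x$ on $V$. The Leibniz locus is the closed subscheme $\mathrm{Leib}(V)=\{x\in V^{2,1}:F(x)=0\}$, where $$F(x)(a,b,c)=\mu_x(\mu_x(a,b),c)-\mu_x(\mu_x(a,c),b)-\mu_x(a,\mu_x(b,c))$$ (right Leibniz identity; $n^4$ quadratic equations in the structure constants). $\mathrm{GL}(V)$ acts by $(g\cdot\mu)(a,b)=g\,\mu(g^{-1}a,g^{-1}b)$. $C^p=C^p(V,V)=\mathrm{Hom}(V^{\otimes p},V)$ are the right Leibniz cochains with adjoint coefficients. The coboundaries are, for $f\in C^1$, $(\delta_xf)(a,b)=\mu_x(f(a),b)+\mu_x(a,f(b))-f(\mu_x(a,b))$, and for $\varphi\in C^2$, $$(\delta_x\varphi)(a,b,c)=\mu_x(\varphi(a,b),c)-\mu_x(\varphi(a,c),b)-\mu_x(a,\varphi(b,c))+\varphi(\mu_x(a,b),c)-\varphi(\mu_x(a,c),b)-\varphi(a,\mu_x(b,c)).$$ The tangent space of the quotient stack $[\mathrm{Leib}(V)/\mathrm{GL}(V)]$ at $[x]$ is the space of first-order deformations of $x$ modulo those induced by the group action, i.e. $T_x\mathrm{Leib}(V)/T_x(\mathrm{GL}(V)\cdot x)$. *)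

theory Defs
  imports
    Complex_Main
    "HOL-Library.Function_Algebras"
    "HOL-Computational_Algebra.Polynomial"
begin

text \<open>
  Throughout, \<open>s :: 'k \<Rightarrow> 'v \<Rightarrow> 'v\<close> is the scalar multiplication of the vector space \<open>V\<close>, whose
  carrier is the whole type \<open>'v\<close>. A map out of a tensor power of \<open>V\<close> is rendered as a curried
  multilinear map. Functions are added and multiplied pointwise (Function_Algebras).
\<close>

subsection \<open>Subspaces, quotients and linear isomorphisms\<close>

record ('k, 'a) vsp =
  vcarrier :: "'a set"
  vadd :: "'a \<Rightarrow> 'a \<Rightarrow> 'a"
  vsmult :: "'k \<Rightarrow> 'a \<Rightarrow> 'a"

definition subsp :: "('k \<Rightarrow> 'a \<Rightarrow> 'a) \<Rightarrow> 'a set \<Rightarrow> ('k, 'a::ab_group_add) vsp" where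
  "subsp sm A = \<lparr>vcarrier = A, vadd = (+), vsmult = sm\<rparr>"

text \<open>
  The quotient \<open>A / B\<close> by a subspace \<open>B\<close> of \<open>A\<close>, with the cosets \<open>u + B\<close> as elements. In the
  scalar multiplication, \<open>B\<close> is added so that \<open>0 \<cdot> (u + B)\<close> is the coset \<open>B\<close> and not \<open>{0}\<close>.
\<close>
definition quotsp :: "('k \<Rightarrow> 'a \<Rightarrow> 'a) \<Rightarrow> 'a set \<Rightarrow> 'a set \<Rightarrow> ('k, 'a::ab_group_add set) vsp" where
  "quotsp sm A B =
    \<lparr>vcarrier = {{u + b | b. b \<in> B} | u. u \<in> A},
     vadd = (\<lambda>X Y. {u + w | u w. u \<in> X \<and> w \<in> Y}),
     vsmult = (\<lambda>c X. {sm c u + b | u b. u \<in> X \<and> b \<in> B})\<rparr>"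

definition vsp_iso :: "('a \<Rightarrow> 'b) \<Rightarrow> ('k, 'a) vsp \<Rightarrow> ('k, 'b) vsp \<Rightarrow> bool" where
  "vsp_iso f A B \<longleftrightarrow>
     bij_betw f (vcarrier A) (vcarrier B) \<and>
     (\<forall>u\<in>vcarrier A. \<forall>w\<in>vcarrier A. f (vadd A u w) = vadd B (f u) (f w)) \<and>
     (\<forall>c. \<forall>u\<in>vcarrier A. f (vsmult A c u) = vsmult B c (f u))"

subsection \<open>Cochains and Leibniz cohomology in degree two\<close>

type_synonym 'v product = "'v \<Rightarrow> 'v \<Rightarrow> 'v"

definition C1 :: "('k::field \<Rightarrow> 'v::ab_group_add \<Rightarrow> 'v) \<Rightarrow> ('v \<Rightarrow> 'v) set" where
  "C1 s = {f. Vector_Spaces.linear s s f}"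

text \<open>\<open>C2 s\<close> is also the space \<open>V\<^sup>2\<^sup>,\<^sup>1\<close> of bilinear products.\<close>
definition C2 :: "('k::field \<Rightarrow> 'v::ab_group_add \<Rightarrow> 'v) \<Rightarrow> 'v product set" where
  "C2 s = {\<phi>. (\<forall>a. Vector_Spaces.linear s s (\<lambda>b. \<phi> a b)) \<and>
              (\<forall>b. Vector_Spaces.linear s s (\<lambda>a. \<phi> a b))}"

definition smult2 :: "('k \<Rightarrow> 'v \<Rightarrow> 'v) \<Rightarrow> 'k \<Rightarrow> 'v product \<Rightarrow> 'v product" where
  "smult2 s c \<phi> = (\<lambda>a b. s c (\<phi> a b))"

definition leibniz_F :: "'v::ab_group_add product \<Rightarrow> 'v \<Rightarrow> 'v \<Rightarrow> 'v \<Rightarrow> 'v" where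
  "leibniz_F x a b c = x (x a b) c - x (x a c) b - x a (x b c)"

definition delta1 :: "'v::ab_group_add product \<Rightarrow> ('v \<Rightarrow> 'v) \<Rightarrow> 'v product" where
  "delta1 x f = (\<lambda>a b. x (f a) b + x a (f b) - f (x a b))"

definition delta2 :: "'v::ab_group_add product \<Rightarrow> 'v product \<Rightarrow> 'v \<Rightarrow> 'v \<Rightarrow> 'v \<Rightarrow> 'v" where
  "delta2 x \<phi> = (\<lambda>a b c.
     x (\<phi> a b) c - x (\<phi> a c) b - x a (\<phi> b c)
     + \<phi> (x a b) c - \<phi> (x a c) b - \<phi> a (x b c))"

definition Z2 :: "('k::field \<Rightarrow> 'v::ab_group_add \<Rightarrow> 'v) \<Rightarrow> 'v product \<Rightarrow> 'v product set" where
  "Z2 s x = {\<phi> \<in> C2 s. delta2 x \<phi> = (\<lambda>a b c. 0)}"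

definition B2 :: "('k::field \<Rightarrow> 'v::ab_group_add \<Rightarrow> 'v) \<Rightarrow> 'v product \<Rightarrow> 'v product set" where
  "B2 s x = delta1 x ` C1 s"

definition H2 ::
  "('k::field \<Rightarrow> 'v::ab_group_add \<Rightarrow> 'v) \<Rightarrow> 'v product \<Rightarrow> ('k, 'v product set) vsp" where
  "H2 s x = quotsp (smult2 s) (Z2 s x) (B2 s x)"

subsection \<open>The affine space of products and its Zariski tangent spaces\<close>

text \<open>
  The coordinate ring \<open>k[V\<^sup>2\<^sup>,\<^sup>1]\<close>, as the ring of polynomial functions on \<open>C2 s\<close>; since \<open>k\<close> will
  be infinite and \<open>V\<close> finite-dimensional, this is the polynomial ring in the structure constants.
  A function on \<open>C2 s\<close> is extended by \<open>0\<close> to all of \<open>'v product\<close>, so that equality of elements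
  is equality on \<open>C2 s\<close>; the unit is thus the indicator function of \<open>C2 s\<close>.
\<close>
inductive_set coord_ring ::
  "('k::field \<Rightarrow> 'v::ab_group_add \<Rightarrow> 'v) \<Rightarrow> ('v product \<Rightarrow> 'k) set"
  for s :: "'k \<Rightarrow> 'v \<Rightarrow> 'v" where
  const: "(\<lambda>y. if y \<in> C2 s then c else 0) \<in> coord_ring s"
| coord: "Vector_Spaces.linear s (*) f \<Longrightarrow>
    (\<lambda>y. if y \<in> C2 s then f (y a b) else 0) \<in> coord_ring s"
| add: "p \<in> coord_ring s \<Longrightarrow> q \<in> coord_ring s \<Longrightarrow> p + q \<in> coord_ring s"
| mult: "p \<in> coord_ring s \<Longrightarrow> q \<in> coord_ring s \<Longrightarrow> p * q \<in> coord_ring s"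

inductive_set ideal_generated :: "'r::comm_ring set \<Rightarrow> 'r set \<Rightarrow> 'r set"
  for R G where
  zero: "0 \<in> ideal_generated R G"
| step: "p \<in> ideal_generated R G \<Longrightarrow> r \<in> R \<Longrightarrow> g \<in> G \<Longrightarrow> p + r * g \<in> ideal_generated R G"

definition max_ideal ::
  "('k::field \<Rightarrow> 'v::ab_group_add \<Rightarrow> 'v) \<Rightarrow> 'v product \<Rightarrow> ('v product \<Rightarrow> 'k) set" where
  "max_ideal s x = {p \<in> coord_ring s. p x = 0}"

text \<open>
  The Zariski tangent space at the rational point \<open>x\<close> of the closed subscheme of \<open>V\<^sup>2\<^sup>,\<^sup>1\<close> cut out by
  an ideal \<open>I\<close> (with \<open>I\<close> contained in \<open>m = max_ideal s x\<close>). The ideal of \<open>x\<close> in \<open>k[V\<^sup>2\<^sup>,\<^sup>1] / I\<close> is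
  \<open>n = m / I\<close>, and \<open>n / n\<^sup>2 = m / (m\<^sup>2 + I)\<close>; its dual consists of the linear forms on \<open>m\<close> that
  vanish on \<open>m\<^sup>2\<close> and on \<open>I\<close>. They are extended by \<open>0\<close> outside \<open>m\<close>.
\<close>
definition zariski_tangent ::
  "('k::field \<Rightarrow> 'v::ab_group_add \<Rightarrow> 'v) \<Rightarrow> ('v product \<Rightarrow> 'k) set \<Rightarrow> 'v product
    \<Rightarrow> (('v product \<Rightarrow> 'k) \<Rightarrow> 'k) set" where
  "zariski_tangent s I x = {l.
     (\<forall>p. p \<notin> max_ideal s x \<longrightarrow> l p = 0) \<and>
     (\<forall>p\<in>max_ideal s x. \<forall>q\<in>max_ideal s x. l (p + q) = l p + l q) \<and>
     (\<forall>c. \<forall>p\<in>max_ideal s x. l (\<lambda>y. c * p y) = c * l p) \<and>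
     (\<forall>p\<in>max_ideal s x. \<forall>q\<in>max_ideal s x. l (p * q) = 0) \<and>
     (\<forall>p\<in>I. l p = 0)}"

definition smult_form :: "'k::times \<Rightarrow> ('p \<Rightarrow> 'k) \<Rightarrow> 'p \<Rightarrow> 'k" where
  "smult_form c l = (\<lambda>p. c * l p)"

text \<open>
  The canonical map from vectors \<open>\<phi>\<close> of \<open>V\<^sup>2\<^sup>,\<^sup>1\<close> to tangent vectors at \<open>x\<close>: a function \<open>p\<close> vanishing
  at \<open>x\<close> is sent to the coefficient of \<open>t\<close> in the polynomial \<open>p (x + t \<phi>)\<close>.
\<close>
definition tangent_vector ::
  "('k::field \<Rightarrow> 'v::ab_group_add \<Rightarrow> 'v) \<Rightarrow> 'v product \<Rightarrow> 'v product
    \<Rightarrow> ('v product \<Rightarrow> 'k) \<Rightarrow> 'k" where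
  "tangent_vector s x \<phi> = (\<lambda>p.
     if p \<in> max_ideal s x
     then coeff (THE q. \<forall>t. poly q t = p (x + smult2 s t \<phi>)) 1
     else 0)"

subsection \<open>The Leibniz locus, the orbits and the quotient stack\<close>

definition Leib :: "('k::field \<Rightarrow> 'v::ab_group_add \<Rightarrow> 'v) \<Rightarrow> 'v product set" where
  "Leib s = {x \<in> C2 s. \<forall>a b c. leibniz_F x a b c = 0}"

text \<open>
  \<open>Leib s\<close> above is only the set of rational points; the scheme is given by the ideal generated by
  the coordinates of \<open>F\<close>, which need not be radical.
\<close>
definition leib_ideal ::
  "('k::field \<Rightarrow> 'v::ab_group_add \<Rightarrow> 'v) \<Rightarrow> ('v product \<Rightarrow> 'k) set" where
  "leib_ideal s = ideal_generated (coord_ring s)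
     {(\<lambda>y. if y \<in> C2 s then f (leibniz_F y a b c) else 0) | f a b c. Vector_Spaces.linear s (*) f}"

definition GL :: "('k::field \<Rightarrow> 'v::ab_group_add \<Rightarrow> 'v) \<Rightarrow> ('v \<Rightarrow> 'v) set" where
  "GL s = {g. Vector_Spaces.linear s s g \<and> bij g}"

definition act :: "('v \<Rightarrow> 'v) \<Rightarrow> 'v product \<Rightarrow> 'v product" where
  "act g x = (\<lambda>a b. g (x (inv g a) (inv g b)))"

definition orbit :: "('k::field \<Rightarrow> 'v::ab_group_add \<Rightarrow> 'v) \<Rightarrow> 'v product \<Rightarrow> 'v product set" where
  "orbit s x = {act g x | g. g \<in> GL s}"

definition vanishing_ideal ::
  "('k::field \<Rightarrow> 'v::ab_group_add \<Rightarrow> 'v) \<Rightarrow> 'v product set \<Rightarrow> ('v product \<Rightarrow> 'k) set" where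
  "vanishing_ideal s Y = {p \<in> coord_ring s. \<forall>y\<in>Y. p y = 0}"

definition T_Leib ::
  "('k::field \<Rightarrow> 'v::ab_group_add \<Rightarrow> 'v) \<Rightarrow> 'v product \<Rightarrow> (('v product \<Rightarrow> 'k) \<Rightarrow> 'k) set" where
  "T_Leib s x = zariski_tangent s (leib_ideal s) x"

text \<open>
  The orbit is a locally closed subvariety (reduced), open in its closure, so its tangent space at
  \<open>x\<close> is that of the closure, whose ideal is the vanishing ideal of the orbit. As \<open>k\<close> will be
  infinite, the rational points of \<open>GL(V)\<close> are dense and suffice for computing this ideal.
\<close>
definition T_orbit ::
  "('k::field \<Rightarrow> 'v::ab_group_add \<Rightarrow> 'v) \<Rightarrow> 'v product \<Rightarrow> (('v product \<Rightarrow> 'k) \<Rightarrow> 'k) set" where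
  "T_orbit s x = zariski_tangent s (vanishing_ideal s (orbit s x)) x"

definition T_stack ::
  "('k::field \<Rightarrow> 'v::ab_group_add \<Rightarrow> 'v) \<Rightarrow> 'v product
    \<Rightarrow> ('k, (('v product \<Rightarrow> 'k) \<Rightarrow> 'k) set) vsp" where
  "T_stack s x = quotsp smult_form (T_Leib s x) (T_orbit s x)"

end

theory Submission
  imports Defs
begin

text \<open>
  A tangent vector is determined by its values on coordinate functions, so the Zariski tangent space
  of an ideal \<open>I\<close> at \<open>x\<close> consists of the \<open>\<phi>\<close> whose directional derivatives at \<open>x\<close> annihilate \<open>I\<close>;
  differentiating \<open>F\<close> gives the cocycle condition for the Leibniz ideal.

  That coboundaries are tangent to the orbit is seen along the lines \<open>1 + t f\<close>. Conversely, let \<open>\<phi>\<close>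
  annihilate the ideal of the orbit. Over a field \<open>K\<close> in which the regular functions of \<open>g\<close> in \<open>GL(V)\<close>
  embed, \<open>p(g \<cdot> x) \<mapsto> (d p)(g \<cdot> \<phi>)\<close> is a well-defined derivation, and in characteristic \<open>0\<close> it
  extends to \<open>K\<close>. Differentiating \<open>(g \<cdot> x)(g a, g b) = g (x(a, b))\<close> then shows that \<open>\<phi>\<close> is a
  coboundary over \<open>K\<close>. Here \<open>K\<close> is the quotient of the ring of all functions of \<open>g\<close> by a maximal
  ideal; as finitely many elements of that ideal have a common zero, the conclusion descends to \<open>k\<close>
  by evaluating at such a zero.
\<close>

text \<open>The hard inclusion, that orbit tangents are coboundaries, says that the orbit map g -> g
  . x is separable; this can fail in characteristic p. Extending a derivation through algebraic
  elements is where separability enters, since the derivative of a minimal polynomial must not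
  vanish. The derivation is well defined by homogeneity: each g carries \<phi> to a vector tangent
  to the orbit at g . x, so a function vanishing on the orbit has zero derivative along all these
  vectors. The extension is applied to the matrix entries of g and yields a tangent direction of
  GL(V) that the orbit map sends to g . \<phi>. Taking K as a residue field of all functions, rather
  than the fraction field of the regular ones, avoids determinants and localisation and keeps
  evaluation at actual points available: a nowhere vanishing function is a unit, so every member of
  a proper ideal has a zero.\<close>

subsection \<open>Extending derivations to a residue field\<close>

definition subring :: "'a::comm_ring_1 set \<Rightarrow> bool" where
  "subring D \<longleftrightarrow> 1 \<in> D \<and> (\<forall>a\<in>D. - a \<in> D) \<and> (\<forall>a\<in>D. \<forall>b\<in>D. a + b \<in> D \<and> a * b \<in> D)"

definition proper_ideal :: "'a::comm_ring_1 set \<Rightarrow> bool" where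
  "proper_ideal I \<longleftrightarrow> 0 \<in> I \<and> 1 \<notin> I \<and> (\<forall>a\<in>I. \<forall>b\<in>I. a + b \<in> I) \<and> (\<forall>a\<in>I. \<forall>r. r * a \<in> I)"

lemma subringD:
  assumes "subring D"
  shows "1 \<in> D" "0 \<in> D" "a \<in> D \<Longrightarrow> - a \<in> D" "a \<in> D \<Longrightarrow> b \<in> D \<Longrightarrow> a + b \<in> D"
    "a \<in> D \<Longrightarrow> b \<in> D \<Longrightarrow> a - b \<in> D" "a \<in> D \<Longrightarrow> b \<in> D \<Longrightarrow> a * b \<in> D"
proof -
  show *: "1 \<in> D" "a \<in> D \<Longrightarrow> - a \<in> D" "a \<in> D \<Longrightarrow> b \<in> D \<Longrightarrow> a + b \<in> D"
    "a \<in> D \<Longrightarrow> b \<in> D \<Longrightarrow> a * b \<in> D" for a b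
    using assms by (auto simp: subring_def)
  from *(3)[OF *(1) *(2)[OF *(1)]] show "0 \<in> D" by simp
  from *(3)[of a "- b"] *(2)[of b] show "a \<in> D \<Longrightarrow> b \<in> D \<Longrightarrow> a - b \<in> D" by simp
qed

lemma subring_sum: "subring D \<Longrightarrow> (\<And>i. i \<in> A \<Longrightarrow> f i \<in> D) \<Longrightarrow> sum f A \<in> D"
  by (induction A rule: infinite_finite_induct) (auto intro: subringD)

lemma subring_of_nat: "subring D \<Longrightarrow> of_nat n \<in> D"
  by (induction n) (auto intro: subringD)

lemma proper_idealD:
  assumes "proper_ideal I"
  shows "0 \<in> I" "1 \<notin> I" "a \<in> I \<Longrightarrow> b \<in> I \<Longrightarrow> a + b \<in> I" "a \<in> I \<Longrightarrow> r * a \<in> I"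
    "a \<in> I \<Longrightarrow> a * r \<in> I" "a \<in> I \<Longrightarrow> - a \<in> I" "a \<in> I \<Longrightarrow> b \<in> I \<Longrightarrow> a - b \<in> I"
proof -
  show *: "0 \<in> I" "1 \<notin> I" "a \<in> I \<Longrightarrow> b \<in> I \<Longrightarrow> a + b \<in> I" "a \<in> I \<Longrightarrow> r * a \<in> I" for a b r
    using assms by (auto simp: proper_ideal_def)
  from *(4)[of a r] show "a \<in> I \<Longrightarrow> a * r \<in> I" by (simp add: mult.commute)
  from *(4)[of _ "-1"] have m: "a \<in> I \<Longrightarrow> - a \<in> I" for a by simp
  then show "a \<in> I \<Longrightarrow> - a \<in> I" .
  from *(3)[of a "- b"] m[of b] show "a \<in> I \<Longrightarrow> b \<in> I \<Longrightarrow> a - b \<in> I" by simp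
qed

text \<open>Krull's theorem by Zorn. Maximality is recorded as inverses modulo M, the form in which
  it is used: without an inverse for a, the ideal M + (a) would still be proper.\<close>

lemma maximal_ideal_exists:
  fixes J :: "'a::comm_ring_1 set"
  assumes "proper_ideal J"
  obtains M where "proper_ideal M" "J \<subseteq> M" "\<And>a. a \<notin> M \<Longrightarrow> \<exists>b. b * a - 1 \<in> M"
proof -
  define \<A> where "\<A> = {I. proper_ideal I \<and> J \<subseteq> I}"
  have "\<exists>M\<in>\<A>. \<forall>X\<in>\<A>. M \<subseteq> X \<longrightarrow> X = M"
  proof (rule subset_Zorn_nonempty)
    show "\<A> \<noteq> {}" using assms by (auto simp: \<A>_def)
    fix \<C> assume ne: "\<C> \<noteq> {}" and ch: "subset.chain \<A> \<C>"
    then have sub: "\<C> \<subseteq> \<A>" and tot: "\<And>X Y. X \<in> \<C> \<Longrightarrow> Y \<in> \<C> \<Longrightarrow> X \<subseteq> Y \<or> Y \<subseteq> X"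
      by (auto simp: subset.chain_def)
    have id: "proper_ideal X" if "X \<in> \<C>" for X using that sub by (auto simp: \<A>_def)
    have "proper_ideal (\<Union>\<C>)"
      unfolding proper_ideal_def
    proof (intro conjI ballI allI)
      show "0 \<in> \<Union>\<C>" using ne id proper_idealD(1) by blast
      show "1 \<notin> \<Union>\<C>" using id proper_idealD(2) by blast
      show "a + b \<in> \<Union>\<C>" if ab: "a \<in> \<Union>\<C>" "b \<in> \<Union>\<C>" for a b
      proof -
        from ab obtain X Y where "X \<in> \<C>" "Y \<in> \<C>" "a \<in> X" "b \<in> Y" by blast
        with tot[of X Y] obtain Z where "Z \<in> \<C>" "a \<in> Z" "b \<in> Z" by blast
        then show ?thesis using id proper_idealD(3) by blast
      qed
      show "r * a \<in> \<Union>\<C>" if "a \<in> \<Union>\<C>" for a r using that id proper_idealD(4) by blast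
    qed
    moreover have "J \<subseteq> \<Union>\<C>" using ne sub by (auto simp: \<A>_def)
    ultimately show "\<Union>\<C> \<in> \<A>" by (simp add: \<A>_def)
  qed
  then obtain M where M: "proper_ideal M" "J \<subseteq> M"
    and max: "\<And>X. proper_ideal X \<Longrightarrow> M \<subseteq> X \<Longrightarrow> X = M"
    by (auto simp: \<A>_def)
  have "\<exists>b. b * a - 1 \<in> M" if a: "a \<notin> M" for a
  proof (rule ccontr)
    assume no: "\<nexists>b. b * a - 1 \<in> M"
    define X where "X = {m + r * a | m r. m \<in> M}"
    have 1: "1 \<notin> X"
    proof
      assume "1 \<in> X"
      then obtain m r where "m \<in> M" "1 = m + r * a" by (auto simp: X_def)
      then have "r * a - 1 = - m" by (metis add_diff_cancel_right' minus_diff_eq)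
      with proper_idealD(6)[OF M(1) \<open>m \<in> M\<close>] no show False by metis
    qed
    have XI: "m + r * a \<in> X" if "m \<in> M" for m r using that by (auto simp: X_def)
    have "m \<in> X" if "m \<in> M" for m using XI[OF that, of 0] by simp
    moreover have "proper_ideal X"
      unfolding proper_ideal_def
    proof (intro conjI ballI allI 1)
      show "0 \<in> X" using calculation[OF proper_idealD(1)[OF M(1)]] .
      fix u assume "u \<in> X"
      then obtain m r where u: "m \<in> M" "u = m + r * a" by (auto simp: X_def)
      show "t * u \<in> X" for t
        using XI[OF proper_idealD(4)[OF M(1) u(1)], of t "t * r"] u(2) by (simp add: algebra_simps)
      fix v assume "v \<in> X"
      then obtain m' r' where v: "m' \<in> M" "v = m' + r' * a" by (auto simp: X_def)
      show "u + v \<in> X"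
        using XI[OF proper_idealD(3)[OF M(1) u(1) v(1)], of "r + r'"] u(2) v(2)
        by (simp add: algebra_simps)
    qed
    ultimately have "X = M" using max by blast
    moreover have "a \<in> X" using XI[OF proper_idealD(1)[OF M(1)], of 1] by simp
    ultimately show False using a by blast
  qed
  with M that show thesis by blast
qed

text \<open>Each f in the ideal brings the indicator of its support into it. Finitely many such
  indicators combine to that of the union of the supports, which would be 1 without a common
  zero.\<close>

lemma proper_ideal_common_zero:
  fixes M :: "('i \<Rightarrow> 'k::field) set"
  assumes M: "proper_ideal M" and "finite F" "F \<subseteq> M"
  obtains i where "\<And>f. f \<in> F \<Longrightarrow> f i = 0"
proof -
  have "(\<lambda>i. if \<exists>f\<in>F. f i \<noteq> 0 then 1 else 0) \<in> M"
    using assms(2,3)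
  proof (induction F)
    case empty
    have "(\<lambda>i. 0) \<in> M" using proper_idealD(1)[OF M] by (simp add: zero_fun_def)
    then show ?case by simp
  next
    case (insert f F)
    let ?e = "\<lambda>i. if \<exists>f\<in>F. f i \<noteq> 0 then 1 else 0 :: 'k"
    let ?d = "\<lambda>i. if f i \<noteq> 0 then 1 else 0 :: 'k"
    have "?d = f * (\<lambda>i. inverse (f i))" by (auto simp: fun_eq_iff)
    then have "?d \<in> M" using insert proper_idealD(5)[OF M, of f] by auto
    moreover have "?e \<in> M" using insert by auto
    \<comment> \<open>For indicators d and e of two sets, d + (1 - d) e is the indicator of their
      union.\<close>
    ultimately have "?d + (1 - ?d) * ?e \<in> M" by (intro proper_idealD(3,4)[OF M])
    moreover have "?d + (1 - ?d) * ?e = (\<lambda>i. if \<exists>f\<in>insert f F. f i \<noteq> 0 then 1 else 0)"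
      by (auto simp: fun_eq_iff)
    ultimately show ?case by simp
  qed
  moreover have "1 \<notin> M" by (rule proper_idealD(2)[OF M])
  ultimately have "(\<lambda>i. if \<exists>f\<in>F. f i \<noteq> 0 then 1 else 0) \<noteq> (1 :: 'i \<Rightarrow> 'k)" by metis
  then have "\<exists>i. \<forall>f\<in>F. f i = 0" by (auto simp: fun_eq_iff split: if_splits)
  with that show thesis by blast
qed

section \<open>Dual numbers over a residue field\<close>

lemma coeff_mult_1: "coeff (p * q) 1 = coeff p 0 * coeff q 1 + coeff p 1 * coeff q (0::nat)"
  by (simp add: coeff_mult atMost_Suc add.commute)

text \<open>The residue field is never formed: equality in it means a difference in M, so that
  representatives stay functions that can later be evaluated.\<close>

locale residue_field_char_0 =
  fixes M :: "'a::comm_ring_1 set"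
  assumes ideal: "proper_ideal M"
    and invertible: "a \<notin> M \<Longrightarrow> \<exists>b. b * a - 1 \<in> M"
    and of_nat_notin: "n > 0 \<Longrightarrow> of_nat n \<notin> M"
begin

lemma prime:
  assumes "a * b \<in> M" "a \<notin> M" shows "b \<in> M"
proof -
  obtain c where c: "c * a - 1 \<in> M" using invertible assms(2) by blast
  have "c * (a * b) - b * (c * a - 1) \<in> M"
    by (rule proper_idealD(7)[OF ideal proper_idealD(4)[OF ideal assms(1)] proper_idealD(4)[OF ideal c]])
  also have "c * (a * b) - b * (c * a - 1) = b" by (simp add: algebra_simps)
  finally show ?thesis .
qed

text \<open>
  A polynomial stands for its class modulo the square of the variable, i.e. for a dual number. A
  subring of dual numbers subject to the second condition is the graph of a derivation, with
  values in the residue field of \<open>M\<close>, on the subring of constant terms.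
\<close>
definition derivation_graph :: "'a poly set \<Rightarrow> bool" where
  "derivation_graph D \<longleftrightarrow> subring D \<and> (\<forall>q\<in>D. coeff q 0 \<in> M \<longrightarrow> coeff q 1 \<in> M)"

text \<open>Zero as a dual number over the residue field.\<close>

definition negligible :: "'a poly \<Rightarrow> bool" where
  "negligible q \<longleftrightarrow> coeff q 0 \<in> M \<and> coeff q 1 \<in> M"

lemma negligible_add: "negligible p \<Longrightarrow> negligible q \<Longrightarrow> negligible (p + q)"
  by (simp add: negligible_def proper_idealD(3)[OF ideal])

lemma negligible_mult: "negligible p \<Longrightarrow> negligible (q * p)"
  unfolding negligible_def coeff_mult_0 coeff_mult_1
  by (intro conjI proper_idealD(3,4)[OF ideal]) auto

text \<open>Over the residue field, a dual number with nonzero constant term is a unit.\<close>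

lemma negligible_cancel:
  assumes "negligible (q * p)" "coeff q 0 \<notin> M" shows "negligible p"
proof -
  have 0: "coeff p 0 \<in> M" using prime[OF _ assms(2)] assms(1) by (simp add: negligible_def coeff_mult_0)
  have "coeff q 0 * coeff p 1 + coeff q 1 * coeff p 0 - coeff q 1 * coeff p 0 \<in> M"
    using assms(1) proper_idealD(4)[OF ideal 0] unfolding negligible_def coeff_mult_1
    by (intro proper_idealD(7)[OF ideal]) auto
  then have "coeff q 0 * coeff p 1 \<in> M" by (simp only: add_diff_cancel_right')
  from prime[OF this assms(2)] 0 show ?thesis by (simp add: negligible_def)
qed

lemma coeff_linear_power:
  fixes z \<zeta> :: 'a
  shows
  "coeff ([:z, \<zeta>:] ^ i) 0 = z ^ i"
  "coeff ([:z, \<zeta>:] ^ i) 1 = of_nat i * z ^ (i - 1) * \<zeta>"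
proof -
  show 0: "coeff ([:z, \<zeta>:] ^ i) 0 = z ^ i" for i
  proof (induction i)
    case (Suc i)
    then show ?case by (simp only: power_Suc coeff_mult_0 coeff_pCons_0)
  qed simp
  show "coeff ([:z, \<zeta>:] ^ i) 1 = of_nat i * z ^ (i - 1) * \<zeta>"
  proof (induction i)
    case (Suc i)
    have "coeff ([:z, \<zeta>:] ^ Suc i) 1 = z * (of_nat i * z ^ (i - 1) * \<zeta>) + \<zeta> * z ^ i"
      using Suc by (simp only: power_Suc coeff_mult_1 0) simp
    also have "\<dots> = of_nat (Suc i) * z ^ (Suc i - 1) * \<zeta>"
      by (cases i) (auto simp: algebra_simps)
    finally show ?case .
  qed simp
qed

text \<open>The derivative of a polynomial expression at z splits into the part that differentiates
  the coefficients and \<zeta> times the formal derivative at z. The truncated exponent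
  \<open>i - 1\<close> at \<open>i = 0\<close> is killed by the factor
  \<open>of_nat i\<close>.\<close>

lemma coeff_eval:
  fixes z \<zeta> :: 'a
  shows
  "coeff (\<Sum>i<n. c i * [:z, \<zeta>:] ^ i) 0 = (\<Sum>i<n. coeff (c i) 0 * z ^ i)"
  "coeff (\<Sum>i<n. c i * [:z, \<zeta>:] ^ i) 1 =
    (\<Sum>i<n. coeff (c i) 1 * z ^ i) + (\<Sum>i<n. of_nat i * coeff (c i) 0 * z ^ (i - 1)) * \<zeta>"
  unfolding coeff_sum coeff_mult_0 coeff_mult_1 coeff_linear_power sum_distrib_right
    sum.distrib[symmetric]
  by (rule refl) (rule sum.cong, simp_all only: ac_simps)

text \<open>
  If \<open>z\<close> is algebraic over the constant terms of \<open>D\<close>, then \<open>\<zeta>\<close> is forced by a polynomial of minimal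
  degree vanishing at \<open>z\<close>, since its derivative does not vanish at \<open>z\<close> in characteristic \<open>0\<close>.
\<close>
lemma derivation_value_exists:
  assumes D: "derivation_graph D"
  shows "\<exists>\<zeta>. \<forall>c n. (\<forall>i. c i \<in> D) \<longrightarrow> coeff (\<Sum>i<n. c i * [:z, \<zeta>:] ^ i) 0 \<in> M \<longrightarrow>
    negligible (\<Sum>i<n. c i * [:z, \<zeta>:] ^ i)"
proof -
  have sD: "subring D" and gD: "\<And>q. q \<in> D \<Longrightarrow> coeff q 0 \<in> M \<Longrightarrow> negligible q"
    using D by (auto simp: derivation_graph_def negligible_def)
  note sr = subringD[OF sD]
  \<comment> \<open>A polynomial of exact degree d over the constant terms of D that has z as a root
    in the residue field.\<close>
  define alg where "alg c d \<longleftrightarrow> (\<forall>i. c i \<in> D) \<and> coeff (c d) 0 \<notin> M \<and>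
    (\<Sum>i<Suc d. coeff (c i) 0 * z ^ i) \<in> M" for c d
  obtain \<zeta> where \<zeta>: "\<And>c' m. alg c' m \<Longrightarrow>
    \<exists>c d. d \<le> m \<and> alg c d \<and> negligible (\<Sum>i<Suc d. c i * [:z, \<zeta>:] ^ i)"
  proof (cases "\<exists>d c. alg c d")
    case True
    define d where "d = (LEAST d. \<exists>c. alg c d)"
    obtain c where c: "alg c d" using LeastI_ex[OF True] by (auto simp: d_def)
    have min: "d \<le> m" if "alg c' m" for c' m
      unfolding d_def using that by (auto intro: Least_le)
    have d0: "d > 0"
    proof (rule ccontr)
      assume "\<not> d > 0"
      then show False using c by (simp add: alg_def)
    qed
    define s where "s = (\<Sum>i<Suc d. of_nat i * coeff (c i) 0 * z ^ (i - 1))"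
    define t where "t = (\<Sum>i<Suc d. coeff (c i) 1 * z ^ i)"
    have s_eq: "s = (\<Sum>i<Suc (d - 1). coeff (of_nat (Suc i) * c (Suc i)) 0 * z ^ i)"
      unfolding s_def using d0 by (subst sum.lessThan_Suc_shift) (simp add: coeff_mult_0 of_nat_poly)
    \<comment> \<open>s is the formal derivative at z. Were it zero, the derivative, whose leading
      coefficient d c_d is nonzero in characteristic 0, would be a relation of degree d - 1.\<close>
    have "s \<notin> M"
    proof
      assume "s \<in> M"
      have "alg (\<lambda>i. of_nat (Suc i) * c (Suc i)) (d - 1)"
        unfolding alg_def
      proof (intro conjI allI)
        show "of_nat (Suc i) * c (Suc i) \<in> D" for i
          using c subring_of_nat[OF sD, of "Suc i"] unfolding alg_def by (blast intro: sr)
        show "(\<Sum>i<Suc (d - 1). coeff (of_nat (Suc i) * c (Suc i)) 0 * z ^ i) \<in> M"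
          using \<open>s \<in> M\<close> s_eq by simp
        have "of_nat d * coeff (c d) 0 \<notin> M"
          using prime[OF _ of_nat_notin[OF d0]] c unfolding alg_def by blast
        then show "coeff (of_nat (Suc (d - 1)) * c (Suc (d - 1))) 0 \<notin> M"
          using d0 by (simp add: coeff_mult_0 of_nat_poly)
      qed
      from min[OF this] d0 show False by simp
    qed
    then obtain u where u: "u * s - 1 \<in> M" using invertible by blast
    \<comment> \<open>Differentiating the minimal relation requires t + s \<zeta> = 0, and u inverts
      s.\<close>
    define \<zeta> where "\<zeta> = - (u * t)"
    have "t + s * \<zeta> = (- t) * (u * s - 1)" by (simp add: \<zeta>_def algebra_simps)
    then have "t + s * \<zeta> \<in> M" using proper_idealD(4)[OF ideal u] by metis
    then have "negligible (\<Sum>i<Suc d. c i * [:z, \<zeta>:] ^ i)"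
      using c unfolding negligible_def coeff_eval alg_def s_def t_def by blast
    with c min that show thesis by blast
  \<comment> \<open>If z is transcendental, \<open>alg\<close> never holds and every \<zeta> will
    do.\<close>
  qed (use that in blast)
  \<comment> \<open>Any relation at z is reduced by pseudo-division. As D is only a ring, the
    leading coefficient of the divisor is multiplied in, and cancelled at the end.\<close>
  have "negligible (\<Sum>i<n. c i * [:z, \<zeta>:] ^ i)"
    if "\<And>i. c i \<in> D" "coeff (\<Sum>i<n. c i * [:z, \<zeta>:] ^ i) 0 \<in> M" for n c
    using that
  proof (induction n arbitrary: c)
    case 0
    then show ?case by (simp add: negligible_def)
  next
    case (Suc m)
    let ?w = "[:z, \<zeta>:]"
    let ?ev = "\<lambda>n c. \<Sum>i<n. c i * ?w ^ i"
    show ?case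
    proof (cases "coeff (c m) 0 \<in> M")
      case True
      then have top: "negligible (c m * ?w ^ m)"
        using gD[OF Suc.prems(1)] negligible_mult[of "c m" "?w ^ m"] by (simp add: mult.commute)
      have "coeff (?ev (Suc m) c) 0 - coeff (c m * ?w ^ m) 0 \<in> M"
        using Suc.prems(2) top unfolding negligible_def by (blast intro: proper_idealD(7)[OF ideal])
      then have "coeff (?ev m c) 0 \<in> M" by simp
      from Suc.IH[OF Suc.prems(1) this] top show ?thesis by (simp add: negligible_add)
    next
      case False
      have "alg c m"
        using False Suc.prems unfolding alg_def coeff_eval by blast
      from \<zeta>[OF this] obtain b d where d: "d \<le> m" and b: "alg b d"
        and nb: "negligible (?ev (Suc d) b)" by blast
      \<comment> \<open>The coefficients of b_d c - c_m X^(m-d) b, whose term of degree m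
        cancels.\<close>
      define e where "e i = b d * c i - (if i < m - d then 0 else c m * b (i - (m - d)))" for i
      have bD: "b i \<in> D" for i using b by (simp add: alg_def)
      have eD: "e i \<in> D" for i
        using sr(2) sr(6)[OF bD Suc.prems(1)] sr(6)[OF Suc.prems(1) bD]
        unfolding e_def by (auto intro: sr(5))
      have "(\<Sum>i<Suc m. (if i < m - d then 0 else c m * b (i - (m - d))) * ?w ^ i)
          = (\<Sum>i\<in>{m - d..<Suc m}. c m * b (i - (m - d)) * ?w ^ i)"
        by (intro sum.mono_neutral_cong_right) auto
      also have "\<dots> = (\<Sum>i\<in>{0 + (m - d)..<Suc d + (m - d)}. c m * b (i - (m - d)) * ?w ^ i)"
        using d by simp
      also have "\<dots> = (\<Sum>i\<in>{0..<Suc d}. c m * b i * ?w ^ (i + (m - d)))"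
        by (subst sum.shift_bounds_nat_ivl) (simp del: sum.op_ivl_Suc)
      also have "\<dots> = (c m * ?w ^ (m - d)) * ?ev (Suc d) b"
        unfolding sum_distrib_left atLeast0LessThan
        by (intro sum.cong refl) (simp add: power_add algebra_simps del: mult_pCons_left mult_pCons_right)
      finally have shift: "(\<Sum>i<Suc m. (if i < m - d then 0 else c m * b (i - (m - d))) * ?w ^ i)
        = (c m * ?w ^ (m - d)) * ?ev (Suc d) b" .
      have "e m = 0" using d by (simp add: e_def mult.commute)
      then have "?ev m e = ?ev (Suc m) e" by simp
      also have "\<dots> = b d * ?ev (Suc m) c - (c m * ?w ^ (m - d)) * ?ev (Suc d) b"
        unfolding shift[symmetric] e_def sum_distrib_left[of "b d"] sum_subtractf[symmetric]
        by (intro sum.cong refl) (simp only: left_diff_distrib mult.assoc)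
      finally have e_eq: "?ev m e = b d * ?ev (Suc m) c - (c m * ?w ^ (m - d)) * ?ev (Suc d) b" .
      have nb': "negligible ((c m * ?w ^ (m - d)) * ?ev (Suc d) b)"
        by (rule negligible_mult[OF nb])
      have "coeff (b d * ?ev (Suc m) c) 0 \<in> M"
        unfolding coeff_mult_0 by (rule proper_idealD(4)[OF ideal Suc.prems(2)])
      then have "coeff (?ev m e) 0 \<in> M"
        using nb' unfolding e_eq coeff_diff negligible_def
        by (blast intro: proper_idealD(7)[OF ideal])
      from negligible_add[OF Suc.IH[OF eD this] nb']
      have "negligible (b d * ?ev (Suc m) c)" unfolding e_eq by simp
      then show ?thesis using b by (auto simp: alg_def intro: negligible_cancel)
    qed
  qed
  then show ?thesis by (intro exI[of _ \<zeta>]) simp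
qed

text \<open>In a graph E maximal by Zorn, every z already has a value: for the \<zeta> of
  \<open>derivation_value_exists\<close>, the polynomials in \<open>[:z, \<zeta>:]\<close> over E
  form a graph again, hence equal E.\<close>

lemma derivation_extension:
  assumes D: "derivation_graph D"
  obtains E where "derivation_graph E" "D \<subseteq> E" "\<And>z. \<exists>\<zeta>. [:z, \<zeta>:] \<in> E"
proof -
  define \<A> where "\<A> = {E. derivation_graph E \<and> D \<subseteq> E}"
  have "\<exists>E\<in>\<A>. \<forall>X\<in>\<A>. E \<subseteq> X \<longrightarrow> X = E"
  proof (rule subset_Zorn_nonempty)
    show "\<A> \<noteq> {}" using D by (auto simp: \<A>_def)
    fix \<C> assume ne: "\<C> \<noteq> {}" and ch: "subset.chain \<A> \<C>"
    then have sub: "\<C> \<subseteq> \<A>" and tot: "\<And>X Y. X \<in> \<C> \<Longrightarrow> Y \<in> \<C> \<Longrightarrow> X \<subseteq> Y \<or> Y \<subseteq> X"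
      by (auto simp: subset.chain_def)
    have gr: "derivation_graph X" if "X \<in> \<C>" for X using that sub by (auto simp: \<A>_def)
    then have sr: "subring X" if "X \<in> \<C>" for X using that by (auto simp: derivation_graph_def)
    have "subring (\<Union>\<C>)"
      unfolding subring_def
    proof (intro conjI ballI)
      show "1 \<in> \<Union>\<C>" using ne sr subringD(1) by blast
      show "- a \<in> \<Union>\<C>" if "a \<in> \<Union>\<C>" for a using that sr subringD(3) by blast
      fix a b assume "a \<in> \<Union>\<C>" "b \<in> \<Union>\<C>"
      then obtain X Y where "X \<in> \<C>" "Y \<in> \<C>" "a \<in> X" "b \<in> Y" by blast
      with tot[of X Y] obtain Z where "Z \<in> \<C>" "a \<in> Z" "b \<in> Z" by blast
      then show "a + b \<in> \<Union>\<C>" "a * b \<in> \<Union>\<C>" using sr subringD(4,6) by blast+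
    qed
    then have "derivation_graph (\<Union>\<C>)" using gr by (auto simp: derivation_graph_def)
    moreover have "D \<subseteq> \<Union>\<C>" using ne sub by (auto simp: \<A>_def)
    ultimately show "\<Union>\<C> \<in> \<A>" by (simp add: \<A>_def)
  qed
  then obtain E where E: "derivation_graph E" "D \<subseteq> E"
    and max: "\<And>X. derivation_graph X \<Longrightarrow> E \<subseteq> X \<Longrightarrow> X = E"
    by (auto simp: \<A>_def)
  have sE: "subring E" using E by (simp add: derivation_graph_def)
  have "\<exists>\<zeta>. [:z, \<zeta>:] \<in> E" for z
  proof -
    obtain \<zeta> where \<zeta>: "\<forall>c n. (\<forall>i. c i \<in> E) \<longrightarrow> coeff (\<Sum>i<n. c i * [:z, \<zeta>:] ^ i) 0 \<in> M \<longrightarrow>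
      negligible (\<Sum>i<n. c i * [:z, \<zeta>:] ^ i)"
      using derivation_value_exists[OF E(1), of z] by (rule exE)
    let ?w = "[:z, \<zeta>:]"
    define X where "X = {poly p ?w | p. \<forall>i. coeff p i \<in> E}"
    have XI: "poly p ?w \<in> X" if "\<And>i. coeff p i \<in> E" for p using that by (auto simp: X_def)
    have "subring X"
      unfolding subring_def
    proof (intro conjI ballI)
      show "1 \<in> X" using XI[of 1] subringD(1,2)[OF sE] by (simp add: coeff_1)
      fix a assume "a \<in> X"
      then obtain p where p: "a = poly p ?w" "\<And>i. coeff p i \<in> E" by (auto simp: X_def)
      show "- a \<in> X" using XI[of "- p"] p subringD(3)[OF sE] by simp
      fix b assume "b \<in> X"
      then obtain q where q: "b = poly q ?w" "\<And>i. coeff q i \<in> E" by (auto simp: X_def)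
      show "a + b \<in> X" using XI[of "p + q"] p q subringD(4)[OF sE] by simp
      have "coeff (p * q) i \<in> E" for i
        unfolding coeff_mult by (intro subring_sum[OF sE] subringD(6)[OF sE] p q)
      then show "a * b \<in> X" using XI[of "p * q"] p q by simp
    qed
    moreover have "coeff q 1 \<in> M" if "q \<in> X" "coeff q 0 \<in> M" for q
    proof -
      from that(1) obtain p where p: "q = poly p ?w" "\<And>i. coeff p i \<in> E" by (auto simp: X_def)
      then have "q = (\<Sum>i<Suc (degree p). coeff p i * ?w ^ i)"
        by (simp only: poly_altdef lessThan_Suc_atMost)
      with \<zeta>[rule_format, of "coeff p" "Suc (degree p)", OF p(2)] that(2) show ?thesis
        unfolding negligible_def by simp
    qed
    ultimately have "derivation_graph X" by (auto simp: derivation_graph_def)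
    moreover have "E \<subseteq> X"
    proof
      fix e assume "e \<in> E"
      then show "e \<in> X" using XI[of "[:e:]"] subringD(2)[OF sE] by (simp add: coeff_pCons split: nat.splits)
    qed
    ultimately have "X = E" using max by blast
    moreover have "?w \<in> X"
      using XI[of "[:0, 1:]"] subringD(1,2)[OF sE] by (simp add: coeff_pCons split: nat.splits)
    ultimately show ?thesis by blast
  qed
  with E that show thesis by blast
qed

end

subsection \<open>Polynomial functions on the space of products\<close>

locale fin_dim_space = finite_dimensional_vector_space s Basis
  for s :: "'k::field_char_0 \<Rightarrow> 'v::ab_group_add \<Rightarrow> 'v" and Basis :: "'v set"
begin

lemma vector_space_mult: "vector_space ((*) :: 'k \<Rightarrow> 'k \<Rightarrow> 'k)"
  by unfold_locales (auto simp: algebra_simps)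

lemma form_iff: "Vector_Spaces.linear s (*) f \<longleftrightarrow>
    (\<forall>u v. f (u + v) = f u + f v) \<and> (\<forall>c v. f (s c v) = c * f v)"
  using vector_space_mult vector_space_axioms
  by (auto simp: Vector_Spaces.linear_def module_hom_def module_hom_axioms_def module_iff_vector_space)

lemma endo_iff: "Vector_Spaces.linear s s f \<longleftrightarrow>
    (\<forall>u v. f (u + v) = f u + f v) \<and> (\<forall>c v. f (s c v) = s c (f v))"
  using vector_space_axioms
  by (auto simp: Vector_Spaces.linear_def module_hom_def module_hom_axioms_def module_iff_vector_space)

lemma form_simps:
  assumes "Vector_Spaces.linear s (*) f"
  shows "f (u + v) = f u + f v" "f (s c v) = c * f v" "f 0 = 0" "f (- v) = - f v"
    "f (u - v) = f u - f v" "f (sum g A) = (\<Sum>a\<in>A. f (g a))"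
proof -
  interpret f: Vector_Spaces.linear s "(*)" f by fact
  show "f (u + v) = f u + f v" "f (s c v) = c * f v" "f 0 = 0" "f (- v) = - f v"
    "f (u - v) = f u - f v" "f (sum g A) = (\<Sum>a\<in>A. f (g a))"
    by (fact f.add f.scale f.zero f.neg f.diff f.sum)+
qed

lemma endo_simps:
  assumes "Vector_Spaces.linear s s f"
  shows "f (u + v) = f u + f v" "f (s c v) = s c (f v)" "f 0 = 0" "f (- v) = - f v"
    "f (u - v) = f u - f v" "f (sum g A) = (\<Sum>a\<in>A. f (g a))"
proof -
  interpret f: Vector_Spaces.linear s s f by fact
  show "f (u + v) = f u + f v" "f (s c v) = s c (f v)" "f 0 = 0" "f (- v) = - f v"
    "f (u - v) = f u - f v" "f (sum g A) = (\<Sum>a\<in>A. f (g a))"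
    by (fact f.add f.scale f.zero f.neg f.diff f.sum)+
qed

text \<open>The basis vector comes first so that \<open>crd e\<close> is itself a linear
  form.\<close>

definition crd :: "'v \<Rightarrow> 'v \<Rightarrow> 'k" where
  "crd e v = representation Basis v e"

lemma form_crd: "Vector_Spaces.linear s (*) (crd e)"
  unfolding crd_def form_iff
  by (simp add: representation_add representation_scale independent_Basis span_Basis)

lemma crd_expand: "(\<Sum>e\<in>Basis. s (crd e v) e) = v"
  unfolding crd_def by (rule sum_representation_eq) (auto simp: independent_Basis span_Basis finite_Basis)

lemma crd_Basis: "b \<in> Basis \<Longrightarrow> crd e b = (if b = e then 1 else 0)"
  unfolding crd_def by (subst representation_basis) (auto simp: independent_Basis)

lemma form_expand: "Vector_Spaces.linear s (*) f \<Longrightarrow> f v = (\<Sum>e\<in>Basis. crd e v * f e)"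
  by (subst (1) crd_expand[symmetric]) (simp add: form_simps)

lemma endo_expand: "Vector_Spaces.linear s s f \<Longrightarrow> f v = (\<Sum>e\<in>Basis. s (crd e v) (f e))"
  by (subst (1) crd_expand[symmetric]) (simp add: endo_simps)

lemma eq_by_crd: "(\<And>e. e \<in> Basis \<Longrightarrow> crd e u = crd e v) \<Longrightarrow> u = v"
  by (metis (no_types, lifting) crd_expand sum.cong)

lemma crd_sum:
  assumes "e \<in> Basis" shows "crd e (\<Sum>b\<in>Basis. s (g b) b) = g e"
proof -
  have "crd e (\<Sum>b\<in>Basis. s (g b) b) = (\<Sum>b\<in>Basis. g b * (if b = e then 1 else 0))"
    by (simp add: form_simps[OF form_crd] crd_Basis cong: sum.cong)
  then show ?thesis using assms finite_Basis by (simp add: if_distrib cong: if_cong)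
qed

lemma endo_on_Basis:
  "Vector_Spaces.linear s s (\<lambda>v. \<Sum>e\<in>Basis. s (crd e v) (w e))" (is ?l)
  "b \<in> Basis \<Longrightarrow> (\<Sum>e\<in>Basis. s (crd e b) (w e)) = w b"
proof -
  show ?l unfolding endo_iff
    by (simp add: form_simps[OF form_crd] scale_left_distrib sum.distrib scale_sum_right)
  assume b: "b \<in> Basis"
  then have "(\<Sum>e\<in>Basis. s (crd e b) (w e)) = (\<Sum>e\<in>Basis. if b = e then w e else 0)"
    by (intro sum.cong) (auto simp: crd_Basis)
  then show "(\<Sum>e\<in>Basis. s (crd e b) (w e)) = w b" using b finite_Basis by simp
qed

lemma C2_simps:
  assumes "y \<in> C2 s"
  shows "y (u + v) w = y u w + y v w" "y w (u + v) = y w u + y w v"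
    "y (s c v) w = s c (y v w)" "y w (s c v) = s c (y w v)"
    "y (u - v) w = y u w - y v w" "y w (u - v) = y w u - y w v"
    "y (- v) w = - y v w" "y w (- v) = - y w v"
    "y 0 w = 0" "y w 0 = 0"
    "y (sum g A) w = (\<Sum>a\<in>A. y (g a) w)" "y w (sum g A) = (\<Sum>a\<in>A. y w (g a))"
  using assms endo_simps[of "\<lambda>a. y a w"] endo_simps[of "y w"] by (auto simp: C2_def)

lemma C2_iff: "y \<in> C2 s \<longleftrightarrow> (\<forall>u v w. y (u + v) w = y u w + y v w \<and> y w (u + v) = y w u + y w v)
    \<and> (\<forall>c v w. y (s c v) w = s c (y v w) \<and> y w (s c v) = s c (y w v))"
  unfolding C2_def endo_iff by auto

lemma C2_add: "y \<in> C2 s \<Longrightarrow> z \<in> C2 s \<Longrightarrow> y + z \<in> C2 s"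
  unfolding C2_iff by (simp add: ac_simps scale_right_distrib)

lemma C2_smult: "y \<in> C2 s \<Longrightarrow> smult2 s c y \<in> C2 s"
  unfolding C2_iff smult2_def by (simp add: scale_right_distrib mult.commute)

lemma C2_expand:
  assumes "y \<in> C2 s"
  shows "y u v = (\<Sum>e\<in>Basis. \<Sum>e'\<in>Basis. s (crd e u * crd e' v) (y e e'))"
proof -
  have "y u v = y (\<Sum>e\<in>Basis. s (crd e u) e) (\<Sum>e\<in>Basis. s (crd e v) e)"
    by (simp add: crd_expand)
  also have "\<dots> = (\<Sum>e\<in>Basis. \<Sum>e'\<in>Basis. s (crd e u * crd e' v) (y e e'))"
    by (simp only: C2_simps(11)[OF assms])
      (simp add: C2_simps[OF assms] scale_sum_right mult.commute)
  finally show ?thesis .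
qed

lemma C2_eq_by_Basis:
  assumes "y \<in> C2 s" "z \<in> C2 s" "\<And>b b'. b \<in> Basis \<Longrightarrow> b' \<in> Basis \<Longrightarrow> y b b' = z b b'"
  shows "y = z"
proof (intro ext)
  show "y u v = z u v" for u v
    using assms(3) by (simp add: C2_expand[OF assms(1), of u v] C2_expand[OF assms(2), of u v])
qed

section \<open>The coordinate ring and directional derivatives\<close>

abbreviation cfun :: "'k \<Rightarrow> 'v product \<Rightarrow> 'k" where
  "cfun c \<equiv> \<lambda>y. if y \<in> C2 s then c else 0"

lemma coord_ring_outside: "p \<in> coord_ring s \<Longrightarrow> y \<notin> C2 s \<Longrightarrow> p y = 0"
  by (induction rule: coord_ring.induct) auto

lemma coord_ring_smult: "p \<in> coord_ring s \<Longrightarrow> (\<lambda>y. c * p y) \<in> coord_ring s"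
proof -
  assume p: "p \<in> coord_ring s"
  have "(\<lambda>y. c * p y) = cfun c * p" using coord_ring_outside[OF p] by (auto simp: fun_eq_iff)
  then show ?thesis using coord_ring.mult[OF coord_ring.const p] by metis
qed

lemma coord_ring_0: "0 \<in> coord_ring s"
  using coord_ring.const[of s 0] by (simp add: zero_fun_def)

lemma coord_ring_uminus: "p \<in> coord_ring s \<Longrightarrow> - p \<in> coord_ring s"
  using coord_ring_smult[of p "-1"] by (simp add: fun_Compl_def)

lemma coord_ring_diff: "p \<in> coord_ring s \<Longrightarrow> q \<in> coord_ring s \<Longrightarrow> p - q \<in> coord_ring s"
  using coord_ring.add[of p s "- q"] coord_ring_uminus[of q] by simp

lemma coord_ring_sum: "(\<And>i. i \<in> A \<Longrightarrow> f i \<in> coord_ring s) \<Longrightarrow> sum f A \<in> coord_ring s"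
  by (induction A rule: infinite_finite_induct) (auto intro: coord_ring_0 coord_ring.add)

text \<open>The same \<open>THE\<close> as in \<open>tangent_vector\<close>, at an arbitrary base
  point and for functions that need not vanish there: derivatives are taken along the whole
  orbit.\<close>

definition line_poly :: "('v product \<Rightarrow> 'k) \<Rightarrow> 'v product \<Rightarrow> 'v product \<Rightarrow> 'k poly" where
  "line_poly p y \<phi> = (THE q. \<forall>t. poly q t = p (y + smult2 s t \<phi>))"

definition dif :: "('v product \<Rightarrow> 'k) \<Rightarrow> 'v product \<Rightarrow> 'v product \<Rightarrow> 'k" where
  "dif p y \<phi> = coeff (line_poly p y \<phi>) 1"

text \<open>A polynomial over an infinite field is determined by its values.\<close>

lemma line_poly_eqI:
  assumes "\<And>t. poly q t = p (y + smult2 s t \<phi>)"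
  shows "line_poly p y \<phi> = q"
  unfolding line_poly_def
proof (rule the_equality)
  show "r = q" if "\<forall>t. poly r t = p (y + smult2 s t \<phi>)" for r
    using that assms by (intro poly_eq_poly_eq_iff[THEN iffD1] ext) simp
qed (use assms in simp)

context
  fixes y \<phi> assumes y: "y \<in> C2 s" and \<phi>: "\<phi> \<in> C2 s"
begin

lemma line_C2: "y + smult2 s t \<phi> \<in> C2 s"
  by (intro C2_add C2_smult y \<phi>)

lemma line_poly_const: "line_poly (cfun c) y \<phi> = [:c:]"
  by (rule line_poly_eqI) (simp add: line_C2)

lemma line_poly_coord:
  assumes "Vector_Spaces.linear s (*) f"
  shows "line_poly (\<lambda>y. if y \<in> C2 s then f (y a b) else 0) y \<phi> = [:f (y a b), f (\<phi> a b):]"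
  by (rule line_poly_eqI) (simp add: line_C2, simp add: smult2_def form_simps[OF assms])

lemma poly_line_poly: "p \<in> coord_ring s \<Longrightarrow> poly (line_poly p y \<phi>) t = p (y + smult2 s t \<phi>)"
proof (induction arbitrary: t rule: coord_ring.induct)
  fix c t show "poly (line_poly (cfun c) y \<phi>) t = cfun c (y + smult2 s t \<phi>)"
    by (simp add: line_poly_const line_C2)
next
  fix f a b t assume f: "Vector_Spaces.linear s (*) f"
  show "poly (line_poly (\<lambda>y. if y \<in> C2 s then f (y a b) else 0) y \<phi>) t =
      (\<lambda>y. if y \<in> C2 s then f (y a b) else 0) (y + smult2 s t \<phi>)"
    by (subst line_poly_coord[OF f]) (simp add: line_C2, simp add: smult2_def form_simps[OF f])
next
  fix p q t
  assume IH: "\<And>t. poly (line_poly p y \<phi>) t = p (y + smult2 s t \<phi>)"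
    "\<And>t. poly (line_poly q y \<phi>) t = q (y + smult2 s t \<phi>)"
  have "line_poly (p + q) y \<phi> = line_poly p y \<phi> + line_poly q y \<phi>"
    by (rule line_poly_eqI) (simp add: IH)
  then show "poly (line_poly (p + q) y \<phi>) t = (p + q) (y + smult2 s t \<phi>)" by (simp add: IH)
  have "line_poly (p * q) y \<phi> = line_poly p y \<phi> * line_poly q y \<phi>"
    by (rule line_poly_eqI) (simp add: IH)
  then show "poly (line_poly (p * q) y \<phi>) t = (p * q) (y + smult2 s t \<phi>)" by (simp add: IH)
qed

lemma coeff_0_line_poly: "p \<in> coord_ring s \<Longrightarrow> coeff (line_poly p y \<phi>) 0 = p y"
proof -
  assume p: "p \<in> coord_ring s"
  have "smult2 s 0 \<phi> = 0" by (simp add: smult2_def fun_eq_iff)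
  then show ?thesis using poly_line_poly[OF p, of 0] by (simp add: poly_0_coeff_0)
qed

lemma dif_const: "dif (cfun c) y \<phi> = 0"
  by (simp add: dif_def line_poly_const)

lemma dif_coord:
  "Vector_Spaces.linear s (*) f \<Longrightarrow> dif (\<lambda>y. if y \<in> C2 s then f (y a b) else 0) y \<phi> = f (\<phi> a b)"
  by (simp add: dif_def line_poly_coord)

lemma dif_add:
  assumes "p \<in> coord_ring s" "q \<in> coord_ring s"
  shows "dif (p + q) y \<phi> = dif p y \<phi> + dif q y \<phi>"
proof -
  have "line_poly (p + q) y \<phi> = line_poly p y \<phi> + line_poly q y \<phi>"
    by (rule line_poly_eqI) (simp add: poly_line_poly assms)
  then show ?thesis by (simp add: dif_def)
qed

lemma dif_mult:
  assumes "p \<in> coord_ring s" "q \<in> coord_ring s"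
  shows "dif (p * q) y \<phi> = p y * dif q y \<phi> + dif p y \<phi> * q y"
proof -
  have "line_poly (p * q) y \<phi> = line_poly p y \<phi> * line_poly q y \<phi>"
    by (rule line_poly_eqI) (simp add: poly_line_poly assms)
  then show ?thesis using assms
    by (simp add: dif_def coeff_mult atMost_Suc coeff_0_line_poly add.commute)
qed

lemma dif_smult:
  assumes "p \<in> coord_ring s"
  shows "dif (\<lambda>y. c * p y) y \<phi> = c * dif p y \<phi>"
proof -
  have "line_poly (\<lambda>y. c * p y) y \<phi> = smult c (line_poly p y \<phi>)"
    by (rule line_poly_eqI) (simp add: poly_line_poly assms)
  then show ?thesis by (simp add: dif_def)
qed

lemma dif_0: "dif 0 y \<phi> = 0"
  using dif_const[of 0] by (simp add: zero_fun_def)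

lemma dif_diff:
  assumes "p \<in> coord_ring s" "q \<in> coord_ring s"
  shows "dif (p - q) y \<phi> = dif p y \<phi> - dif q y \<phi>"
  using dif_add[OF coord_ring_diff[OF assms] assms(2)] by simp

lemma dif_sum:
  "(\<And>i. i \<in> A \<Longrightarrow> f i \<in> coord_ring s) \<Longrightarrow> dif (sum f A) y \<phi> = (\<Sum>i\<in>A. dif (f i) y \<phi>)"
  by (induction A rule: infinite_finite_induct) (auto simp: dif_0 dif_add coord_ring_sum)

end

lemma dif_add_right:
  assumes "p \<in> coord_ring s" "y \<in> C2 s" "\<phi> \<in> C2 s" "\<psi> \<in> C2 s"
  shows "dif p y (\<phi> + \<psi>) = dif p y \<phi> + dif p y \<psi>"
  using assms(1)
proof induction
  note C = assms(2-4) C2_add[OF assms(3,4)]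
  show "dif (cfun c) y (\<phi> + \<psi>) = dif (cfun c) y \<phi> + dif (cfun c) y \<psi>" for c
    by (simp add: dif_const C)
  show "dif (\<lambda>y. if y \<in> C2 s then f (y a b) else 0) y (\<phi> + \<psi>) =
      dif (\<lambda>y. if y \<in> C2 s then f (y a b) else 0) y \<phi> +
      dif (\<lambda>y. if y \<in> C2 s then f (y a b) else 0) y \<psi>"
    if "Vector_Spaces.linear s (*) f" for f a b
    using that by (simp add: dif_coord C form_simps)
  fix p q assume "p \<in> coord_ring s" "q \<in> coord_ring s"
    "dif p y (\<phi> + \<psi>) = dif p y \<phi> + dif p y \<psi>" "dif q y (\<phi> + \<psi>) = dif q y \<phi> + dif q y \<psi>"
  then show "dif (p + q) y (\<phi> + \<psi>) = dif (p + q) y \<phi> + dif (p + q) y \<psi>"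
    "dif (p * q) y (\<phi> + \<psi>) = dif (p * q) y \<phi> + dif (p * q) y \<psi>"
    by (simp_all add: dif_add dif_mult C algebra_simps)
qed

lemma dif_smult_right:
  assumes "p \<in> coord_ring s" "y \<in> C2 s" "\<phi> \<in> C2 s"
  shows "dif p y (smult2 s c \<phi>) = c * dif p y \<phi>"
  using assms(1)
proof induction
  note C = assms(2,3) C2_smult[OF assms(3)]
  show "dif (cfun d) y (smult2 s c \<phi>) = c * dif (cfun d) y \<phi>" for d
    by (simp add: dif_const C)
  show "dif (\<lambda>y. if y \<in> C2 s then f (y a b) else 0) y (smult2 s c \<phi>) =
      c * dif (\<lambda>y. if y \<in> C2 s then f (y a b) else 0) y \<phi>"
    if "Vector_Spaces.linear s (*) f" for f a b
    using that by (simp add: dif_coord C) (simp add: smult2_def form_simps)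
  fix p q assume "p \<in> coord_ring s" "q \<in> coord_ring s"
    "dif p y (smult2 s c \<phi>) = c * dif p y \<phi>" "dif q y (smult2 s c \<phi>) = c * dif q y \<phi>"
  then show "dif (p + q) y (smult2 s c \<phi>) = c * dif (p + q) y \<phi>"
    "dif (p * q) y (smult2 s c \<phi>) = c * dif (p * q) y \<phi>"
    by (simp_all add: dif_add dif_mult C algebra_simps)
qed

end

subsection \<open>Zariski tangent vectors and the Leibniz locus\<close>

lemma sum_fun_apply: "(\<Sum>i\<in>A. f i) y = (\<Sum>i\<in>A. f i y)"
  by (induction A rule: infinite_finite_induct) auto

context fin_dim_space
begin

lemma tangent_vector_eq:
  "tangent_vector s x \<phi> p = (if p \<in> max_ideal s x then dif p x \<phi> else 0)"
  by (simp add: tangent_vector_def dif_def line_poly_def)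

lemma tangent_vector_add:
  assumes "x \<in> C2 s" "\<phi> \<in> C2 s" "\<psi> \<in> C2 s"
  shows "tangent_vector s x (\<phi> + \<psi>) = tangent_vector s x \<phi> + tangent_vector s x \<psi>"
  using assms by (auto simp: fun_eq_iff tangent_vector_eq max_ideal_def dif_add_right)

lemma tangent_vector_smult:
  assumes "x \<in> C2 s" "\<phi> \<in> C2 s"
  shows "tangent_vector s x (smult2 s c \<phi>) = smult_form c (tangent_vector s x \<phi>)"
  using assms by (auto simp: fun_eq_iff tangent_vector_eq max_ideal_def dif_smult_right smult_form_def)

text \<open>The projection of the coordinate ring along the constants onto the maximal ideal at
  x.\<close>

definition at_pt :: "'v product \<Rightarrow> ('v product \<Rightarrow> 'k) \<Rightarrow> 'v product \<Rightarrow> 'k" where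
  "at_pt x p = p - (\<lambda>y. if y \<in> C2 s then p x else 0)"

lemma at_pt_max_ideal: "x \<in> C2 s \<Longrightarrow> p \<in> coord_ring s \<Longrightarrow> at_pt x p \<in> max_ideal s x"
  unfolding at_pt_def max_ideal_def
  using coord_ring_diff[OF _ coord_ring.const] by simp

lemma at_pt_max_ideal_id: "p \<in> max_ideal s x \<Longrightarrow> at_pt x p = p"
  by (auto simp: at_pt_def max_ideal_def fun_eq_iff)

lemma dif_at_pt:
  "x \<in> C2 s \<Longrightarrow> \<phi> \<in> C2 s \<Longrightarrow> p \<in> coord_ring s \<Longrightarrow> dif (at_pt x p) x \<phi> = dif p x \<phi>"
  unfolding at_pt_def by (subst dif_diff) (auto simp: dif_const intro: coord_ring.const)

lemma tangent_vector_inj: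
  assumes x: "x \<in> C2 s"
  shows "inj_on (tangent_vector s x) (C2 s)"
proof (rule inj_onI)
  fix \<phi> \<psi> assume \<phi>: "\<phi> \<in> C2 s" and \<psi>: "\<psi> \<in> C2 s"
    and eq: "tangent_vector s x \<phi> = tangent_vector s x \<psi>"
  show "\<phi> = \<psi>"
  proof (intro ext eq_by_crd)
    fix a b e
    let ?p = "\<lambda>y. if y \<in> C2 s then crd e (y a b) else 0"
    have p: "?p \<in> coord_ring s" by (rule coord_ring.coord[OF form_crd])
    have "dif (at_pt x ?p) x \<phi> = dif (at_pt x ?p) x \<psi>"
      using fun_cong[OF eq, of "at_pt x ?p"] at_pt_max_ideal[OF x p] by (simp add: tangent_vector_eq)
    then have "dif ?p x \<phi> = dif ?p x \<psi>" by (simp only: dif_at_pt x \<phi> \<psi> p)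
    then show "crd e (\<phi> a b) = crd e (\<psi> a b)" by (simp only: dif_coord x \<phi> \<psi> form_crd)
  qed
qed

lemma max_ideal_smult: "p \<in> max_ideal s x \<Longrightarrow> (\<lambda>y. c * p y) \<in> max_ideal s x"
  by (auto simp: max_ideal_def coord_ring_smult)

text \<open>A linear form on the maximal ideal that kills its square becomes, after
  \<open>at_pt\<close>, a derivation at x of the whole coordinate ring, and such derivations agree
  once they agree on coordinate functions.\<close>

lemma zariski_tangent_eq:
  assumes x: "x \<in> C2 s"
  shows "zariski_tangent s I x =
    tangent_vector s x ` {\<phi> \<in> C2 s. \<forall>p\<in>I. tangent_vector s x \<phi> p = 0}"
proof (intro equalityI subsetI)
  fix l assume "l \<in> tangent_vector s x ` {\<phi> \<in> C2 s. \<forall>p\<in>I. tangent_vector s x \<phi> p = 0}"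
  then obtain \<phi> where \<phi>: "\<phi> \<in> C2 s" and l: "l = tangent_vector s x \<phi>"
    and I: "\<And>p. p \<in> I \<Longrightarrow> l p = 0" by blast
  have lm: "l p = dif p x \<phi>" if "p \<in> max_ideal s x" for p
    using that by (simp add: l tangent_vector_eq)
  have m: "p \<in> coord_ring s" "p x = 0" if "p \<in> max_ideal s x" for p
    using that by (auto simp: max_ideal_def)
  have add: "p + q \<in> max_ideal s x" and mult: "p * q \<in> max_ideal s x"
    if "p \<in> max_ideal s x" "q \<in> max_ideal s x" for p q
    using that by (auto simp: max_ideal_def intro: coord_ring.add coord_ring.mult)
  show "l \<in> zariski_tangent s I x"
    unfolding zariski_tangent_def
  proof (intro CollectI conjI allI ballI impI)
    show "l p = 0" if "p \<notin> max_ideal s x" for p using that by (simp add: l tangent_vector_eq)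
    fix p assume p: "p \<in> max_ideal s x"
    show "l (\<lambda>y. c * p y) = c * l p" for c
      by (simp only: lm max_ideal_smult p dif_smult x \<phi> m)
    fix q assume q: "q \<in> max_ideal s x"
    show "l (p + q) = l p + l q" by (simp only: lm add p q dif_add x \<phi> m)
    show "l (p * q) = 0" by (simp add: lm mult p q dif_mult x \<phi> m)
  qed (rule I)
next
  fix l assume l: "l \<in> zariski_tangent s I x"
  have l0: "l p = 0" if "p \<notin> max_ideal s x" for p
    using l that by (simp add: zariski_tangent_def)
  have ladd: "l (p + q) = l p + l q" if "p \<in> max_ideal s x" "q \<in> max_ideal s x" for p q
    using l that by (simp add: zariski_tangent_def)
  have lscale: "l (\<lambda>y. c * p y) = c * l p" if "p \<in> max_ideal s x" for p c
    using l that by (simp add: zariski_tangent_def)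
  have lmult: "l (p * q) = 0" if "p \<in> max_ideal s x" "q \<in> max_ideal s x" for p q
    using l that by (simp add: zariski_tangent_def)
  have lI: "l p = 0" if "p \<in> I" for p
    using l that by (simp add: zariski_tangent_def)
  have m0: "0 \<in> max_ideal s x" by (simp add: max_ideal_def coord_ring_0)
  have l_zero: "l 0 = 0" using ladd[OF m0 m0] by simp
  have msum: "sum f A \<in> max_ideal s x" if "\<And>i. i \<in> A \<Longrightarrow> f i \<in> max_ideal s x" for f and A :: "'v set"
    using that by (induction A rule: infinite_finite_induct)
      (auto simp: coord_ring_0 max_ideal_def intro: coord_ring.add)
  have lsum: "l (sum f A) = (\<Sum>i\<in>A. l (f i))"
    if "\<And>i. i \<in> A \<Longrightarrow> f i \<in> max_ideal s x" for f and A :: "'v set"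
    using that by (induction A rule: infinite_finite_induct) (auto simp: l_zero ladd msum)
  define cf where "cf f a b = at_pt x (\<lambda>y. if y \<in> C2 s then f (y a b) else 0)" for f a b
  have cf: "cf f a b y = (if y \<in> C2 s then f (y a b) - f (x a b) else 0)" for f a b y
    using x by (simp add: cf_def at_pt_def)
  have cf_mem: "cf f a b \<in> max_ideal s x" if "Vector_Spaces.linear s (*) f" for f a b
    unfolding cf_def by (intro at_pt_max_ideal x coord_ring.coord that)
  \<comment> \<open>The only candidate: its coordinates are the values of l on the coordinate
    functions centred at x.\<close>
  define \<phi> where "\<phi> a b = (\<Sum>e\<in>Basis. s (l (cf (crd e) a b)) e)" for a b
  have f\<phi>: "f (\<phi> a b) = l (cf f a b)" if f: "Vector_Spaces.linear s (*) f" for f a b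
  proof -
    have "cf f a b = (\<Sum>e\<in>Basis. (\<lambda>y. f e * cf (crd e) a b y))"
    proof
      fix y
      have "f (y a b) - f (x a b) = (\<Sum>e\<in>Basis. f e * (crd e (y a b) - crd e (x a b)))"
        by (subst (1 2) form_expand[OF f]) (simp add: sum_subtractf algebra_simps)
      then show "cf f a b y = (\<Sum>e\<in>Basis. (\<lambda>y. f e * cf (crd e) a b y)) y"
        by (simp add: cf sum_fun_apply)
    qed
    then have "l (cf f a b) = (\<Sum>e\<in>Basis. l (\<lambda>y. f e * cf (crd e) a b y))"
      by (simp only: lsum max_ideal_smult cf_mem form_crd)
    also have "\<dots> = (\<Sum>e\<in>Basis. f e * l (cf (crd e) a b))"
      by (simp only: lscale cf_mem form_crd)
    also have "\<dots> = f (\<phi> a b)" by (simp add: \<phi>_def form_simps[OF f] mult.commute)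
    finally show ?thesis by simp
  qed
  have \<phi>_C2: "\<phi> \<in> C2 s"
  proof -
    have cfa: "cf (crd e) (u + v) w = cf (crd e) u w + cf (crd e) v w"
      "cf (crd e) w (u + v) = cf (crd e) w u + cf (crd e) w v"
      "cf (crd e) (s c v) w = (\<lambda>y. c * cf (crd e) v w y)"
      "cf (crd e) w (s c v) = (\<lambda>y. c * cf (crd e) w v y)" for e u v w c
      using x by (auto simp: cf fun_eq_iff C2_simps form_simps[OF form_crd] algebra_simps)
    show ?thesis
      unfolding C2_iff \<phi>_def
      by (simp add: cfa ladd lscale cf_mem form_crd scale_left_distrib sum.distrib scale_sum_right)
  qed
  have main: "l (at_pt x p) = dif p x \<phi>" if "p \<in> coord_ring s" for p
    using that
  proof induction
    fix c
    have "at_pt x (cfun c) = 0" using x by (auto simp: at_pt_def fun_eq_iff)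
    then show "l (at_pt x (cfun c)) = dif (cfun c) x \<phi>"
      by (simp add: l_zero dif_const x \<phi>_C2)
  next
    fix f a b assume f: "Vector_Spaces.linear s (*) f"
    show "l (at_pt x (\<lambda>y. if y \<in> C2 s then f (y a b) else 0)) =
        dif (\<lambda>y. if y \<in> C2 s then f (y a b) else 0) x \<phi>"
      by (subst dif_coord[OF x \<phi>_C2 f]) (simp only: f\<phi>[OF f] cf_def)
  next
    fix p q assume p: "p \<in> coord_ring s" and q: "q \<in> coord_ring s"
      and IH: "l (at_pt x p) = dif p x \<phi>" "l (at_pt x q) = dif q x \<phi>"
    note mem = at_pt_max_ideal[OF x p] at_pt_max_ideal[OF x q]
    have "at_pt x (p + q) = at_pt x p + at_pt x q" by (auto simp: at_pt_def fun_eq_iff)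
    then show "l (at_pt x (p + q)) = dif (p + q) x \<phi>"
      by (simp add: ladd mem IH dif_add x \<phi>_C2 p q)
    \<comment> \<open>Write p = p(x) + p_0 and q = q(x) + q_0. Since l kills p_0 q_0, what remains
      is the product rule.\<close>
    have "at_pt x (p * q) = at_pt x p * at_pt x q +
        ((\<lambda>y. p x * at_pt x q y) + (\<lambda>y. q x * at_pt x p y))"
      using coord_ring_outside[OF p] coord_ring_outside[OF q] by (auto simp: at_pt_def fun_eq_iff algebra_simps)
    moreover have "at_pt x p * at_pt x q \<in> max_ideal s x"
      "(\<lambda>y. p x * at_pt x q y) + (\<lambda>y. q x * at_pt x p y) \<in> max_ideal s x"
      using mem max_ideal_smult[of _ x] by (auto simp: max_ideal_def intro!: coord_ring.mult coord_ring.add)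
    ultimately have "l (at_pt x (p * q)) = p x * dif q x \<phi> + q x * dif p x \<phi>"
      by (simp add: ladd lmult lscale mem max_ideal_smult IH)
    then show "l (at_pt x (p * q)) = dif (p * q) x \<phi>"
      by (simp add: dif_mult x \<phi>_C2 p q algebra_simps)
  qed
  have "l p = tangent_vector s x \<phi> p" for p
    using main[of p] at_pt_max_ideal_id[of p x] l0[of p]
    by (auto simp: tangent_vector_eq max_ideal_def)
  then have "l = tangent_vector s x \<phi>" by blast
  then show "l \<in> tangent_vector s x ` {\<phi> \<in> C2 s. \<forall>p\<in>I. tangent_vector s x \<phi> p = 0}"
    using lI \<phi>_C2 by blast
qed

lemma form_product: "y \<in> C2 s \<Longrightarrow> Vector_Spaces.linear s (*) f \<Longrightarrow>
    Vector_Spaces.linear s (*) (\<lambda>v. f (y v c)) \<and> Vector_Spaces.linear s (*) (\<lambda>v. f (y c v))"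
  unfolding form_iff by (simp add: C2_simps)

text \<open>Expanding the inner product in the basis gives a sum of products of two coordinate
  functions, to which the product rule applies.\<close>

lemma iterated_product_mem_dif:
  assumes f: "Vector_Spaces.linear s (*) f"
  shows "(\<lambda>y. if y \<in> C2 s then f (y (y a b) c) else 0) \<in> coord_ring s" (is "?p \<in> _")
    and "(\<lambda>y. if y \<in> C2 s then f (y a (y b c)) else 0) \<in> coord_ring s" (is "?q \<in> _")
    and "x \<in> C2 s \<Longrightarrow> \<phi> \<in> C2 s \<Longrightarrow>
      dif (\<lambda>y. if y \<in> C2 s then f (y (y a b) c) else 0) x \<phi> = f (\<phi> (x a b) c) + f (x (\<phi> a b) c)"
    and "x \<in> C2 s \<Longrightarrow> \<phi> \<in> C2 s \<Longrightarrow>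
      dif (\<lambda>y. if y \<in> C2 s then f (y a (y b c)) else 0) x \<phi> = f (\<phi> a (x b c)) + f (x a (\<phi> b c))"
proof -
  let ?c = "\<lambda>f a b y. if y \<in> C2 s then f (y a b) else 0 :: 'k"
  have mem: "?c (crd e) a b * ?c f u v \<in> coord_ring s" for e a b u v
    by (intro coord_ring.mult coord_ring.coord f form_crd)
  have p: "?p = (\<Sum>e\<in>Basis. ?c (crd e) a b * ?c f e c)"
  proof
    fix y show "?p y = (\<Sum>e\<in>Basis. ?c (crd e) a b * ?c f e c) y"
      using form_expand[of "\<lambda>v. f (y v c)" "y a b"] form_product[OF _ f, of y c]
      by (simp add: sum_fun_apply)
  qed
  have q: "?q = (\<Sum>e\<in>Basis. ?c (crd e) b c * ?c f a e)"
  proof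
    fix y show "?q y = (\<Sum>e\<in>Basis. ?c (crd e) b c * ?c f a e) y"
      using form_expand[of "\<lambda>v. f (y a v)" "y b c"] form_product[OF _ f, of y a]
      by (simp add: sum_fun_apply)
  qed
  show "?p \<in> coord_ring s" "?q \<in> coord_ring s"
    unfolding p q by (intro coord_ring_sum mem)+
  assume x: "x \<in> C2 s" and \<phi>: "\<phi> \<in> C2 s"
  have d: "dif (?c (crd e) a b * ?c f u v) x \<phi> =
      crd e (x a b) * f (\<phi> u v) + crd e (\<phi> a b) * f (x u v)" for e a b u v
    by (subst dif_mult[OF x \<phi> coord_ring.coord[OF form_crd] coord_ring.coord[OF f]])
      (simp only: dif_coord[OF x \<phi>] form_crd f x if_True)
  have E: "(\<Sum>e\<in>Basis. crd e v * f (y e c)) = f (y v c)"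
    "(\<Sum>e\<in>Basis. crd e v * f (y c e)) = f (y c v)" if "y \<in> C2 s" for y v c
    using form_product[OF that f, of c] form_expand[of "\<lambda>v. f (y v c)" v]
      form_expand[of "\<lambda>v. f (y c v)" v] by auto
  show "dif ?p x \<phi> = f (\<phi> (x a b) c) + f (x (\<phi> a b) c)"
    unfolding p by (subst dif_sum[OF x \<phi> mem]) (simp only: d sum.distrib E[OF x] E[OF \<phi>])
  show "dif ?q x \<phi> = f (\<phi> a (x b c)) + f (x a (\<phi> b c))"
    unfolding q by (subst dif_sum[OF x \<phi> mem]) (simp only: d sum.distrib E[OF x] E[OF \<phi>])
qed

lemma leibniz_F_mem_dif:
  assumes f: "Vector_Spaces.linear s (*) f"
  shows "(\<lambda>y. if y \<in> C2 s then f (leibniz_F y a b c) else 0) \<in> coord_ring s" (is "?p \<in> _")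
    and "x \<in> C2 s \<Longrightarrow> \<phi> \<in> C2 s \<Longrightarrow>
      dif (\<lambda>y. if y \<in> C2 s then f (leibniz_F y a b c) else 0) x \<phi> = f (delta2 x \<phi> a b c)"
proof -
  let ?l = "\<lambda>a b c y. if y \<in> C2 s then f (y (y a b) c) else 0 :: 'k"
  let ?r = "\<lambda>y. if y \<in> C2 s then f (y a (y b c)) else 0 :: 'k"
  have p: "?p = ?l a b c - ?l a c b - ?r"
    by (auto simp: fun_eq_iff leibniz_F_def form_simps[OF f])
  note I = iterated_product_mem_dif[OF f]
  show "?p \<in> coord_ring s"
    unfolding p by (intro coord_ring_diff I(1,2))
  assume x: "x \<in> C2 s" and \<phi>: "\<phi> \<in> C2 s"
  show "dif ?p x \<phi> = f (delta2 x \<phi> a b c)"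
    unfolding p
    by (simp only: dif_diff[OF x \<phi>] coord_ring_diff I(1,2) I(3,4)[OF x \<phi>])
      (simp add: delta2_def form_simps[OF f])
qed

lemma eq_0_by_forms: "(\<And>f. Vector_Spaces.linear s (*) f \<Longrightarrow> f v = 0) \<Longrightarrow> v = 0"
  using form_crd by (intro eq_by_crd) (simp add: form_simps[OF form_crd])

text \<open>The generators g vanish at x, so the derivative of r g there is r(x) times that of g;
  only the generators matter, and their derivatives are the coordinates of
  \<open>delta2 x \<phi>\<close>.\<close>

lemma leib_ideal_annihilator:
  assumes x: "x \<in> Leib s" and \<phi>: "\<phi> \<in> C2 s"
  shows "(\<forall>p\<in>leib_ideal s. tangent_vector s x \<phi> p = 0) \<longleftrightarrow> \<phi> \<in> Z2 s x"
proof
  have xC: "x \<in> C2 s" and xF: "leibniz_F x a b c = 0" for a b c using x by (auto simp: Leib_def)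
  let ?g = "\<lambda>f a b c y. if y \<in> C2 s then f (leibniz_F y a b c) else 0 :: 'k"
  assume L: "\<forall>p\<in>leib_ideal s. tangent_vector s x \<phi> p = 0"
  have "delta2 x \<phi> a b c = 0" for a b c
  proof (rule eq_0_by_forms)
    fix f assume f: "Vector_Spaces.linear s (*) f"
    \<comment> \<open>The unit of the coordinate ring is \<open>cfun 1\<close>, the indicator of
      \<open>C2 s\<close>, and not the constant function 1.\<close>
    have "0 + cfun 1 * ?g f a b c \<in> leib_ideal s"
      unfolding leib_ideal_def
      using f by (intro ideal_generated.step ideal_generated.zero coord_ring.const) blast
    moreover have "0 + cfun 1 * ?g f a b c = ?g f a b c" by (auto simp: fun_eq_iff)
    ultimately have "tangent_vector s x \<phi> (?g f a b c) = 0" using L by simp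
    moreover have "?g f a b c \<in> max_ideal s x"
      unfolding max_ideal_def using leibniz_F_mem_dif(1)[OF f] by (simp add: xF form_simps[OF f])
    ultimately show "f (delta2 x \<phi> a b c) = 0"
      using leibniz_F_mem_dif(2)[OF f xC \<phi>] by (simp add: tangent_vector_eq)
  qed
  then show "\<phi> \<in> Z2 s x" using \<phi> by (auto simp: Z2_def fun_eq_iff)
next
  have xC: "x \<in> C2 s" and xF: "leibniz_F x a b c = 0" for a b c using x by (auto simp: Leib_def)
  let ?g = "\<lambda>f a b c y. if y \<in> C2 s then f (leibniz_F y a b c) else 0 :: 'k"
  let ?G = "{?g f a b c | f a b c. Vector_Spaces.linear s (*) f}"
  assume Z: "\<phi> \<in> Z2 s x"
  have "p \<in> coord_ring s \<and> dif p x \<phi> = 0" if "p \<in> ideal_generated (coord_ring s) ?G" for p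
    using that
  proof induction
    show "0 \<in> coord_ring s \<and> dif 0 x \<phi> = 0" by (simp add: coord_ring_0 dif_0 xC \<phi>)
    fix p r g assume p: "p \<in> coord_ring s \<and> dif p x \<phi> = 0" and r: "r \<in> coord_ring s" and "g \<in> ?G"
    then obtain f a b c where f: "Vector_Spaces.linear s (*) f" and g: "g = ?g f a b c" by blast
    have "g \<in> coord_ring s" "g x = 0" "dif g x \<phi> = 0"
      using leibniz_F_mem_dif[OF f] Z xC \<phi> by (simp_all add: g xF form_simps[OF f] Z2_def)
    with p r show "p + r * g \<in> coord_ring s \<and> dif (p + r * g) x \<phi> = 0"
      by (simp add: dif_add dif_mult xC \<phi> coord_ring.mult coord_ring.add)
  qed
  then show "\<forall>p\<in>leib_ideal s. tangent_vector s x \<phi> p = 0"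
    by (simp add: leib_ideal_def tangent_vector_eq)
qed

lemma T_Leib_eq: "x \<in> Leib s \<Longrightarrow> T_Leib s x = tangent_vector s x ` Z2 s x"
proof -
  assume x: "x \<in> Leib s"
  then have "T_Leib s x = tangent_vector s x `
      {\<phi> \<in> C2 s. \<forall>p\<in>leib_ideal s. tangent_vector s x \<phi> p = 0}"
    unfolding T_Leib_def by (intro zariski_tangent_eq) (simp add: Leib_def)
  also have "{\<phi> \<in> C2 s. \<forall>p\<in>leib_ideal s. tangent_vector s x \<phi> p = 0} = Z2 s x"
    using leib_ideal_annihilator[OF x] by (auto simp: Z2_def)
  finally show ?thesis .
qed

subsection \<open>Rational functions on the general linear group\<close>

lemma GL_simps:
  assumes "g \<in> GL s"
  shows "Vector_Spaces.linear s s g" "bij g" "g (inv g v) = v" "inv g (g v) = v"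
    "Vector_Spaces.linear s s (inv g)"
proof -
  show lin: "Vector_Spaces.linear s s g" and b: "bij g" using assms by (auto simp: GL_def)
  show gi: "g (inv g v) = v" and ig: "inv g (g v) = v" for v
    using b by (auto simp: bij_def surj_f_inv_f inv_f_f)
  have "inv g (u + v) = inv g u + inv g v" "inv g (s c v) = s c (inv g v)" for u v c
    using ig[of "inv g u + inv g v"] ig[of "s c (inv g v)"] by (simp_all add: endo_simps[OF lin] gi)
  then show "Vector_Spaces.linear s s (inv g)" by (simp add: endo_iff)
qed

lemma id_GL: "id \<in> GL s"
  by (auto simp: GL_def endo_iff)

lemma GL_comp: "g \<in> GL s \<Longrightarrow> h \<in> GL s \<Longrightarrow> g \<circ> h \<in> GL s"
  by (auto simp: GL_def endo_iff bij_comp)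

lemma act_comp: "g \<in> GL s \<Longrightarrow> h \<in> GL s \<Longrightarrow> act (g \<circ> h) y = act g (act h y)"
  by (simp add: act_def o_inv_distrib GL_simps(2))

lemma act_C2: "g \<in> GL s \<Longrightarrow> y \<in> C2 s \<Longrightarrow> act g y \<in> C2 s"
  by (simp add: C2_iff act_def endo_simps[OF GL_simps(1)] endo_simps[OF GL_simps(5)])

lemma act_C2_iff: "g \<in> GL s \<Longrightarrow> act g y \<in> C2 s \<longleftrightarrow> y \<in> C2 s"
proof
  assume g: "g \<in> GL s" and y: "act g y \<in> C2 s"
  have "y = (\<lambda>a b. inv g (act g y (g a) (g b)))"
    by (simp add: act_def GL_simps(4)[OF g])
  also have "\<dots> \<in> C2 s"
    using y by (simp add: C2_iff endo_simps[OF GL_simps(1)[OF g]] endo_simps[OF GL_simps(5)[OF g]])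
  finally show "y \<in> C2 s" .
qed (rule act_C2)

lemma act_line: "g \<in> GL s \<Longrightarrow> act g (y + smult2 s t \<phi>) = act g y + smult2 s t (act g \<phi>)"
  by (auto simp: act_def smult2_def fun_eq_iff endo_simps[OF GL_simps(1)])

lemma act_id: "act id y = y"
  by (simp add: act_def)

section \<open>Lines of endomorphisms and inverses along them\<close>

definition line :: "('v \<Rightarrow> 'v) \<Rightarrow> ('v \<Rightarrow> 'v) \<Rightarrow> 'k \<Rightarrow> 'v \<Rightarrow> 'v" where
  "line A C t = (\<lambda>v. A v + s t (C v))"

lemma line_linear:
  "Vector_Spaces.linear s s A \<Longrightarrow> Vector_Spaces.linear s s C \<Longrightarrow> Vector_Spaces.linear s s (line A C t)"
  by (simp add: endo_iff line_def scale_right_distrib ac_simps)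

lemma span_image_coeffs:
  assumes "finite I" "v \<in> span (f ` I)"
  shows "\<exists>c. v = (\<Sum>i\<in>I. s (c i) (f i))"
  using assms(2)
proof (induction rule: span_induct_alt)
  case base
  show ?case by (rule exI[of _ "\<lambda>i. 0"]) simp
next
  case (step a u v)
  then obtain i c where i: "i \<in> I" "u = f i" and c: "v = (\<Sum>i\<in>I. s (c i) (f i))" by blast
  have "s a u = (\<Sum>j\<in>I. s (if j = i then a else 0) (f j))"
  proof -
    have "(\<Sum>j\<in>I. s (if j = i then a else 0) (f j)) = (\<Sum>j\<in>I. if j = i then s a (f j) else 0)"
      by (intro sum.cong) auto
    then show ?thesis using i assms(1) by simp
  qed
  then have "s a u + v = (\<Sum>j\<in>I. s ((if j = i then a else 0) + c j) (f j))"
    by (simp add: c scale_left_distrib sum.distrib)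
  then show ?case by (intro exI[of _ "\<lambda>j. (if j = i then a else 0) + c j"])
qed

text \<open>Otherwise more than dim V vectors would be independent. Applied to b, M b, M^2 b, ...,
  this stands in for the Cayley-Hamilton theorem.\<close>

lemma sequence_dependent:
  fixes f :: "nat \<Rightarrow> 'v"
  shows "\<exists>d c. f d = (\<Sum>i<d. s (c i) (f i))"
proof (rule ccontr)
  assume no: "\<nexists>d c. f d = (\<Sum>i<d. s (c i) (f i))"
  have nspan: "f d \<notin> span (f ` {..<d})" for d
    using span_image_coeffs[of "{..<d}" "f d" f] no by blast
  have "independent (f ` {..<d}) \<and> card (f ` {..<d}) = d" for d
  proof (induction d)
    case (Suc d)
    have "f d \<notin> f ` {..<d}" using nspan[of d] span_base by metis
    then show ?case using Suc nspan[of d] independent_insertI[OF nspan[of d]]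
      by (simp add: lessThan_Suc)
  qed (simp add: independent_empty)
  from this[of "Suc (dim UNIV)"] show False
    using independent_card_le_dim[of "f ` {..<Suc (dim UNIV)}" UNIV] by simp
qed

text \<open>
  With \<open>M = - A\<^sup>-\<^sup>1 C\<close> and \<open>b = A\<^sup>-\<^sup>1 a\<close>, a linear relation between \<open>b, M b, \<dots>, M\<^sup>d b\<close> makes
  \<open>(1 - t M)\<^sup>-\<^sup>1 b\<close> a rational function of \<open>t\<close> with denominator \<open>Q\<close>.
\<close>
lemma inverse_line_rational:
  assumes A: "A \<in> GL s" and C: "Vector_Spaces.linear s s C"
  shows "\<exists>Q h d. coeff Q 0 = 1 \<and> (\<forall>j\<ge>d. h j = 0) \<and> h 0 = inv A a \<and>
    h 1 = s (coeff Q 1) (inv A a) - inv A (C (inv A a)) \<and>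
    (\<forall>t. line A C t (\<Sum>j\<le>d. s (t ^ j) (h j)) = s (poly Q t) a)"
proof -
  note lA = endo_simps[OF GL_simps(1)[OF A]] and lI = endo_simps[OF GL_simps(5)[OF A]]
    and lC = endo_simps[OF C]
  define b where "b = inv A a"
  define M where "M v = - inv A (C v)" for v
  have M: "Vector_Spaces.linear s s M"
    by (simp add: endo_iff M_def lI lC)
  note lM = endo_simps[OF M]
  obtain d c where dep: "(M ^^ d) b = (\<Sum>i<d. s (c i) ((M ^^ i) b))"
    using sequence_dependent[of "\<lambda>i. (M ^^ i) b"] by blast
  \<comment> \<open>With chi(X) = X^d - \<Sum> c_i X^i, so that chi(M) b = 0, these are the
    coefficients of the reversed polynomial Q(t) = t^d chi(1/t).\<close>
  define q where "q j = (if j = 0 then 1 else if j \<le> d then - c (d - j) else 0)" for j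
  \<comment> \<open>Coefficients of the power series Q(t) (1 - t M)^-1 b. The one at d is chi(M) b =
    0, and the recursion \<open>hS\<close> then kills all later ones, so the series is a
    polynomial.\<close>
  define h where "h j = (\<Sum>i\<le>j. s (q i) ((M ^^ (j - i)) b))" for j
  have h0: "h 0 = b" by (simp add: h_def q_def)
  have hS: "h (Suc j) = M (h j) + s (q (Suc j)) b" for j
  proof -
    have "M (h j) = (\<Sum>i\<le>j. s (q i) ((M ^^ (Suc j - i)) b))"
      unfolding h_def lM by (intro sum.cong) (auto simp: Suc_diff_le lM)
    then show ?thesis by (simp add: h_def)
  qed
  have hd: "h d = 0"
  proof -
    have "h d = (M ^^ d) b + (\<Sum>i=1..d. s (q i) ((M ^^ (d - i)) b))"
      unfolding h_def by (simp add: atMost_atLeast0 sum.atLeast_Suc_atMost q_def)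
    also have "(\<Sum>i=1..d. s (q i) ((M ^^ (d - i)) b)) = (\<Sum>i<d. - s (c i) ((M ^^ i) b))"
      by (rule sum.reindex_bij_witness[of _ "\<lambda>i. d - i" "\<lambda>i. d - i"]) (auto simp: q_def)
    finally show ?thesis using dep by (simp add: sum_negf)
  qed
  have hd': "h j = 0" if "j \<ge> d" for j
    using that by (induction rule: dec_induct) (auto simp: hd hS q_def lM)
  define Q where "Q = (\<Sum>j\<le>d. monom (q j) j)"
  have cQ: "coeff Q k = q k" for k
    by (auto simp: Q_def coeff_sum q_def)
  have pQ: "poly Q t = (\<Sum>j\<le>d. q j * t ^ j)" for t
    by (simp add: Q_def poly_sum poly_monom)
  \<comment> \<open>Multiplying the truncated series by 1 - t M telescopes.\<close>
  have tel: "(\<Sum>j\<le>n. s (t ^ j) (h j)) - s t (M (\<Sum>j\<le>n. s (t ^ j) (h j))) =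
      s (\<Sum>j\<le>n. q j * t ^ j) b - s (t ^ Suc n) (M (h n))" for t n
  proof (induction n)
    case 0
    then show ?case by (simp add: h0 q_def)
  next
    case (Suc n)
    then show ?case
      by (simp add: hS lM scale_right_distrib scale_left_distrib algebra_simps)
  qed
  have "line A C t (\<Sum>j\<le>d. s (t ^ j) (h j)) = s (poly Q t) a" for t
  proof -
    let ?u = "\<Sum>j\<le>d. s (t ^ j) (h j)"
    have "A (M ?u) = - C ?u" by (simp add: M_def lA GL_simps(3)[OF A])
    then have "line A C t ?u = A (?u - s t (M ?u))" by (simp add: line_def lA)
    also have "?u - s t (M ?u) = s (poly Q t) b" using tel[of t d] by (simp add: hd pQ lM)
    finally show ?thesis by (simp add: lA b_def GL_simps(3)[OF A])
  qed
  moreover have "h 1 = s (coeff Q 1) b - inv A (C b)"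
    using hS[of 0] by (simp add: h0 cQ M_def)
  ultimately show ?thesis
    using h0 hd' cQ[of 0] unfolding b_def q_def
    by (intro exI[of _ Q] exI[of _ h] exI[of _ d]) auto
qed

text \<open>Instead of a determinant: each basis vector is in the image except at roots of its own
  denominator Q, and a surjective endomorphism of a finite-dimensional space is invertible.\<close>

lemma finite_singular_line:
  assumes A: "A \<in> GL s" and C: "Vector_Spaces.linear s s C"
  shows "finite {t. line A C t \<notin> GL s}"
proof -
  have lin: "Vector_Spaces.linear s s (line A C t)" for t by (intro line_linear GL_simps(1) A C)
  note ll = endo_simps[OF lin]
  have "\<exists>Q. Q \<noteq> 0 \<and> (\<forall>t. poly Q t \<noteq> 0 \<longrightarrow> (\<exists>u. line A C t u = a))" for a
  proof -
    obtain Q h d where Q: "coeff Q 0 = 1"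
      and h: "\<And>t. line A C t (\<Sum>j\<le>d. s (t ^ j) (h j)) = s (poly Q t) a"
      using inverse_line_rational[OF A C, of a] by blast
    have "line A C t (s (inverse (poly Q t)) (\<Sum>j\<le>d. s (t ^ j) (h j))) = a" if "poly Q t \<noteq> 0" for t
      unfolding ll(2) h using that by simp
    moreover have "Q \<noteq> 0" using Q by auto
    ultimately show ?thesis by blast
  qed
  then obtain Q where Q: "\<And>a. Q a \<noteq> 0"
    and onto: "\<And>a t. poly (Q a) t \<noteq> 0 \<Longrightarrow> \<exists>u. line A C t u = a" by metis
  have "line A C t \<in> GL s" if t: "\<forall>e\<in>Basis. poly (Q e) t \<noteq> 0" for t
  proof -
    have "\<forall>e\<in>Basis. \<exists>u. line A C t u = e" using onto t by blast
    then obtain u where u: "\<forall>e\<in>Basis. line A C t (u e) = e" by (rule bchoice[THEN exE])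
    have "line A C t (\<Sum>e\<in>Basis. s (crd e v) (u e)) = v" for v
      unfolding ll using u crd_expand[of v] by simp
    then have "surj (line A C t)" by (rule surjI)
    moreover from linear_surj_imp_inj[OF lin this] have "inj (line A C t)" .
    ultimately show ?thesis using lin by (simp add: GL_def bij_def)
  qed
  then have "{t. line A C t \<notin> GL s} \<subseteq> (\<Union>e\<in>Basis. {t. poly (Q e) t = 0})" by blast
  moreover have "finite (\<Union>e\<in>Basis. {t. poly (Q e) t = 0})"
    using finite_Basis poly_roots_finite[OF Q] by blast
  ultimately show ?thesis by (rule finite_subset)
qed

text \<open>
  \<open>jet f A C c0 c1\<close> says that \<open>t \<mapsto> f (A + t C)\<close> is a rational function on the invertible part of the
  line, regular at \<open>t = 0\<close>, with first-order expansion \<open>c0 + c1 t\<close> there.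
\<close>
definition jet :: "(('v \<Rightarrow> 'v) \<Rightarrow> 'k) \<Rightarrow> ('v \<Rightarrow> 'v) \<Rightarrow> ('v \<Rightarrow> 'v) \<Rightarrow> 'k \<Rightarrow> 'k \<Rightarrow> bool" where
  "jet f A C c0 c1 \<longleftrightarrow> (\<exists>P Q. coeff Q 0 \<noteq> 0 \<and> coeff P 0 = coeff Q 0 * c0 \<and>
    coeff P 1 = coeff Q 1 * c0 + coeff Q 0 * c1 \<and>
    (\<forall>t. line A C t \<in> GL s \<longrightarrow> poly Q t * f (line A C t) = poly P t))"

lemma jetI:
  assumes "coeff Q 0 \<noteq> 0" "coeff P 0 = coeff Q 0 * c0"
    "coeff P 1 = coeff Q 1 * c0 + coeff Q 0 * c1"
    "\<And>t. line A C t \<in> GL s \<Longrightarrow> poly Q t * f (line A C t) = poly P t"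
  shows "jet f A C c0 c1"
  unfolding jet_def using assms by blast

lemma jet_cong: "(\<And>g. g \<in> GL s \<Longrightarrow> f g = f' g) \<Longrightarrow> jet f A C c0 c1 = jet f' A C c0 c1"
  by (simp add: jet_def)

lemma jet_const: "jet (\<lambda>g. c) A C c 0"
  by (rule jetI[of 1 "[:c:]"]) auto

lemma jet_add:
  assumes "jet f A C c0 c1" "jet f' A C d0 d1"
  shows "jet (\<lambda>g. f g + f' g) A C (c0 + d0) (c1 + d1)"
proof -
  obtain P Q where 1: "coeff Q 0 \<noteq> 0" "coeff P 0 = coeff Q 0 * c0"
    "coeff P 1 = coeff Q 1 * c0 + coeff Q 0 * c1"
    "\<And>t. line A C t \<in> GL s \<Longrightarrow> poly Q t * f (line A C t) = poly P t"
    using assms(1) unfolding jet_def by blast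
  obtain P' Q' where 2: "coeff Q' 0 \<noteq> 0" "coeff P' 0 = coeff Q' 0 * d0"
    "coeff P' 1 = coeff Q' 1 * d0 + coeff Q' 0 * d1"
    "\<And>t. line A C t \<in> GL s \<Longrightarrow> poly Q' t * f' (line A C t) = poly P' t"
    using assms(2) unfolding jet_def by blast
  show ?thesis
  proof (rule jetI[of "Q * Q'" "P * Q' + P' * Q"])
    fix t assume t: "line A C t \<in> GL s"
    show "poly (Q * Q') t * (f (line A C t) + f' (line A C t)) = poly (P * Q' + P' * Q) t"
      using 1(4)[OF t, symmetric] 2(4)[OF t, symmetric] by (simp add: algebra_simps)
  qed (use 1(1-3) 2(1-3) in
    \<open>simp_all only: coeff_add coeff_mult_0 coeff_mult_1, simp_all add: algebra_simps\<close>)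
qed

lemma jet_mult:
  assumes "jet f A C c0 c1" "jet f' A C d0 d1"
  shows "jet (\<lambda>g. f g * f' g) A C (c0 * d0) (c0 * d1 + c1 * d0)"
proof -
  obtain P Q where 1: "coeff Q 0 \<noteq> 0" "coeff P 0 = coeff Q 0 * c0"
    "coeff P 1 = coeff Q 1 * c0 + coeff Q 0 * c1"
    "\<And>t. line A C t \<in> GL s \<Longrightarrow> poly Q t * f (line A C t) = poly P t"
    using assms(1) unfolding jet_def by blast
  obtain P' Q' where 2: "coeff Q' 0 \<noteq> 0" "coeff P' 0 = coeff Q' 0 * d0"
    "coeff P' 1 = coeff Q' 1 * d0 + coeff Q' 0 * d1"
    "\<And>t. line A C t \<in> GL s \<Longrightarrow> poly Q' t * f' (line A C t) = poly P' t"
    using assms(2) unfolding jet_def by blast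
  show ?thesis
  proof (rule jetI[of "Q * Q'" "P * P'"])
    fix t assume t: "line A C t \<in> GL s"
    show "poly (Q * Q') t * (f (line A C t) * f' (line A C t)) = poly (P * P') t"
      using 1(4)[OF t, symmetric] 2(4)[OF t, symmetric] by (simp add: algebra_simps)
  qed (use 1(1-3) 2(1-3) in
    \<open>simp_all only: coeff_add coeff_mult_0 coeff_mult_1, simp_all add: algebra_simps\<close>)
qed

lemma jet_sum:
  "(\<And>i. i \<in> I \<Longrightarrow> jet (f i) A C (c i) (d i)) \<Longrightarrow>
    jet (\<lambda>g. \<Sum>i\<in>I. f i g) A C (\<Sum>i\<in>I. c i) (\<Sum>i\<in>I. d i)"
  by (induction I rule: infinite_finite_induct) (auto simp: jet_const jet_add)

lemma jet_apply:
  assumes "Vector_Spaces.linear s (*) f"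
  shows "jet (\<lambda>g. f (g v)) A C (f (A v)) (f (C v))"
  by (rule jetI[of 1 "[:f (A v), f (C v):]"]) (auto simp: line_def form_simps[OF assms])

lemma jet_inverse:
  assumes A: "A \<in> GL s" and C: "Vector_Spaces.linear s s C" and f: "Vector_Spaces.linear s (*) f"
  shows "jet (\<lambda>g. f (inv g a)) A C (f (inv A a)) (- f (inv A (C (inv A a))))"
proof -
  obtain Q h d where Q0: "coeff Q 0 = 1" and hd: "\<And>j. j \<ge> d \<Longrightarrow> h j = 0" and h0: "h 0 = inv A a"
    and h1: "h 1 = s (coeff Q 1) (inv A a) - inv A (C (inv A a))"
    and h: "\<And>t. line A C t (\<Sum>j\<le>d. s (t ^ j) (h j)) = s (poly Q t) a"
    using inverse_line_rational[OF A C, of a] by blast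
  define P where "P = (\<Sum>j\<le>d. monom (f (h j)) j)"
  have cP: "coeff P k = f (h k)" for k
    by (auto simp: P_def coeff_sum hd form_simps[OF f])
  show ?thesis
  proof (rule jetI[of Q P])
    fix t assume t: "line A C t \<in> GL s"
    have "inv (line A C t) (s (poly Q t) a) = (\<Sum>j\<le>d. s (t ^ j) (h j))"
      using GL_simps(4)[OF t] h[of t] by metis
    then have "f (s (poly Q t) (inv (line A C t) a)) = f (\<Sum>j\<le>d. s (t ^ j) (h j))"
      by (simp add: endo_simps[OF GL_simps(5)[OF t]])
    then show "poly Q t * f (inv (line A C t) a) = poly P t"
      by (simp add: form_simps[OF f] P_def poly_sum poly_monom mult.commute)
  qed (simp_all only: cP h0 h1 Q0 form_simps[OF f], simp_all)
qed

text \<open>The numerator P vanishes at all but finitely many t, hence is the zero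
  polynomial.\<close>

lemma jet_vanishing:
  assumes A: "A \<in> GL s" and C: "Vector_Spaces.linear s s C"
    and "jet f A C c0 c1" "\<And>g. g \<in> GL s \<Longrightarrow> f g = 0"
  shows "c1 = 0"
proof -
  obtain P Q where Q0: "coeff Q 0 \<noteq> 0" and P0: "coeff P 0 = coeff Q 0 * c0"
    and P1: "coeff P 1 = coeff Q 1 * c0 + coeff Q 0 * c1"
    and P: "\<And>t. line A C t \<in> GL s \<Longrightarrow> poly Q t * f (line A C t) = poly P t"
    using assms(3) unfolding jet_def by blast
  have "UNIV \<subseteq> {t. line A C t \<notin> GL s} \<union> {t. poly P t = 0}"
    using P assms(4) by force
  then have "infinite {t. poly P t = 0}"
    using finite_singular_line[OF A C] infinite_UNIV_char_0[where 'a='k] finite_subset by blast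
  then have "P = 0" using poly_roots_finite by blast
  then show ?thesis using P0 P1 Q0 by simp
qed

text \<open>A substitute for the coordinate ring of GL(V) that asks only for rationality along lines
  through each point; this is all that irreducibility requires.\<close>

definition regular :: "(('v \<Rightarrow> 'v) \<Rightarrow> 'k) \<Rightarrow> bool" where
  "regular f \<longleftrightarrow> (\<forall>A\<in>GL s. \<forall>C. Vector_Spaces.linear s s C \<longrightarrow> (\<exists>c0 c1. jet f A C c0 c1))"

lemma regular_cong:
  assumes "\<And>g. g \<in> GL s \<Longrightarrow> f g = f' g" shows "regular f = regular f'"
proof -
  have "jet f = jet f'" using jet_cong[of f f', OF assms] by (simp add: fun_eq_iff)
  then show ?thesis by (simp add: regular_def)
qed

lemma regularE:
  assumes "regular f" "A \<in> GL s" "Vector_Spaces.linear s s C"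
  obtains P Q where "coeff Q 0 \<noteq> 0"
    "\<And>t. line A C t \<in> GL s \<Longrightarrow> poly Q t * f (line A C t) = poly P t"
proof -
  obtain c0 c1 where "jet f A C c0 c1" using assms unfolding regular_def by blast
  then show thesis using that unfolding jet_def by blast
qed

lemma regular_const: "regular (\<lambda>g. c)"
  unfolding regular_def by (blast intro: jet_const)

lemma regular_mult: "regular f \<Longrightarrow> regular f' \<Longrightarrow> regular (\<lambda>g. f g * f' g)"
  unfolding regular_def
proof (intro ballI allI impI)
  fix A C
  assume *: "A \<in> GL s" "Vector_Spaces.linear s s C"
    "\<forall>A\<in>GL s. \<forall>C. Vector_Spaces.linear s s C \<longrightarrow> (\<exists>c0 c1. jet f A C c0 c1)"
    "\<forall>A\<in>GL s. \<forall>C. Vector_Spaces.linear s s C \<longrightarrow> (\<exists>c0 c1. jet f' A C c0 c1)"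
  then obtain c0 c1 d0 d1 where "jet f A C c0 c1" "jet f' A C d0 d1" by blast
  from jet_mult[OF this] show "\<exists>c0 c1. jet (\<lambda>g. f g * f' g) A C c0 c1" by blast
qed

text \<open>The general linear group is irreducible: two of its points lie on a common line.\<close>
lemma regular_common_nonzero:
  assumes f: "regular f" and f': "regular f'"
    and A: "A \<in> GL s" "f A \<noteq> 0" and B: "B \<in> GL s" "f' B \<noteq> 0"
  shows "\<exists>g\<in>GL s. f g * f' g \<noteq> 0"
proof -
  \<comment> \<open>The line through A and B is parametrised from both ends, because a denominator
    is known to be nonzero only at parameter 0.\<close>
  let ?C = "\<lambda>v. B v - A v" and ?D = "\<lambda>v. A v - B v"
  have C: "Vector_Spaces.linear s s ?C" and D: "Vector_Spaces.linear s s ?D"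
    using GL_simps(1)[OF A(1)] GL_simps(1)[OF B(1)]
    by (simp_all add: endo_iff scale_right_diff_distrib)
  obtain P Q where P: "\<And>t. line A ?C t \<in> GL s \<Longrightarrow> poly Q t * f (line A ?C t) = poly P t"
    and Q: "coeff Q 0 \<noteq> 0"
    using regularE[OF f A(1) C] by metis
  obtain P' Q' where P': "\<And>t. line B ?D t \<in> GL s \<Longrightarrow> poly Q' t * f' (line B ?D t) = poly P' t"
    and Q': "coeff Q' 0 \<noteq> 0"
    using regularE[OF f' B(1) D] by metis
  have "line A ?C 0 = A" "line B ?D 0 = B" by (simp_all add: line_def)
  then have "poly P 0 \<noteq> 0" "poly P' 0 \<noteq> 0"
    using P[of 0] P'[of 0] A B Q Q' by (auto simp: poly_0_coeff_0)
  then have "P \<noteq> 0" "P' \<noteq> 0" by auto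
  note fin = this[THEN poly_roots_finite]
  have "{t. poly P' (1 - t) = 0} \<subseteq> (\<lambda>t. 1 - t) ` {t. poly P' t = 0}"
  proof
    fix t assume "t \<in> {t. poly P' (1 - t) = 0}"
    then show "t \<in> (\<lambda>t. 1 - t) ` {t. poly P' t = 0}" by (intro image_eqI[of _ _ "1 - t"]) auto
  qed
  with fin(2) have "finite {t. poly P' (1 - t) = 0}" by (meson finite_imageI finite_subset)
  with fin(1) finite_singular_line[OF A(1) C]
  have "finite ({t. line A ?C t \<notin> GL s} \<union> {t. poly P t = 0} \<union> {t. poly P' (1 - t) = 0})" by simp
  from ex_new_if_finite[OF infinite_UNIV_char_0 this]
  obtain t where t: "line A ?C t \<in> GL s" "poly P t \<noteq> 0" "poly P' (1 - t) \<noteq> 0"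
    by auto
  have "line A ?C t = line B ?D (1 - t)"
    by (simp add: line_def fun_eq_iff scale_left_diff_distrib scale_right_diff_distrib)
  then show ?thesis using P[OF t(1)] P'[of "1 - t"] t by (intro bexI[OF _ t(1)]) auto
qed

text \<open>The derivative of \<open>t \<mapsto> act (A + t C) x\<close> at \<open>t = 0\<close>.\<close>
definition orbit_velocity :: "'v product \<Rightarrow> ('v \<Rightarrow> 'v) \<Rightarrow> ('v \<Rightarrow> 'v) \<Rightarrow> 'v product" where
  "orbit_velocity x A C = (\<lambda>a b. C (x (inv A a) (inv A b))
    - A (x (inv A (C (inv A a))) (inv A b)) - A (x (inv A a) (inv A (C (inv A b)))))"

lemma orbit_velocity_C2:
  assumes "x \<in> C2 s" "A \<in> GL s" "Vector_Spaces.linear s s C"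
  shows "orbit_velocity x A C \<in> C2 s"
  unfolding orbit_velocity_def C2_iff
  using endo_simps[OF GL_simps(1)[OF assms(2)]] endo_simps[OF GL_simps(5)[OF assms(2)]]
    endo_simps[OF assms(3)] C2_simps[OF assms(1)]
  by (simp add: scale_right_diff_distrib)

lemma form_act_expand:
  assumes x: "x \<in> C2 s" and A: "Vector_Spaces.linear s s A" and f: "Vector_Spaces.linear s (*) f"
  shows "f (A (x u v)) = (\<Sum>e\<in>Basis. \<Sum>e'\<in>Basis. crd e u * (crd e' v * f (A (x e e'))))"
  by (subst C2_expand[OF x]) (simp add: endo_simps[OF A] form_simps[OF f] mult.assoc)

text \<open>The chain rule for the orbit map. The coordinates of g . x are sums of products of
  entries of g and of its inverse, whose jets are known; sums and products of functions
  follow.\<close>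

lemma jet_act:
  assumes x: "x \<in> C2 s" and A: "A \<in> GL s" and C: "Vector_Spaces.linear s s C"
    and p: "p \<in> coord_ring s"
  shows "jet (\<lambda>g. p (act g x)) A C (p (act A x)) (dif p (act A x) (orbit_velocity x A C))"
  using p
proof induction
  note D = act_C2[OF A x] orbit_velocity_C2[OF x A C]
  fix c
  have "jet (\<lambda>g. cfun c (act g x)) A C c 0"
    by (subst jet_cong[of _ "\<lambda>g. c"]) (auto simp: act_C2 x jet_const)
  then show "jet (\<lambda>g. cfun c (act g x)) A C (cfun c (act A x))
      (dif (cfun c) (act A x) (orbit_velocity x A C))"
    by (simp add: dif_const D)
next
  note D = act_C2[OF A x] orbit_velocity_C2[OF x A C]
  fix f a b assume f: "Vector_Spaces.linear s (*) f"
  let ?u = "inv A a" and ?v = "inv A b"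
  let ?Du = "inv A (C ?u)" and ?Dv = "inv A (C ?v)"
  have "jet (\<lambda>g. \<Sum>e\<in>Basis. \<Sum>e'\<in>Basis. crd e (inv g a) * (crd e' (inv g b) * f (g (x e e')))) A C
    (\<Sum>e\<in>Basis. \<Sum>e'\<in>Basis. crd e ?u * (crd e' ?v * f (A (x e e'))))
    (\<Sum>e\<in>Basis. \<Sum>e'\<in>Basis. crd e ?u * (crd e' ?v * f (C (x e e')) + (- crd e' ?Dv) * f (A (x e e')))
      + (- crd e ?Du) * (crd e' ?v * f (A (x e e'))))"
    by (intro jet_sum jet_mult jet_apply jet_inverse A C f form_crd)
  also have "(\<Sum>e\<in>Basis. \<Sum>e'\<in>Basis. crd e ?u * (crd e' ?v * f (A (x e e')))) = f (act A x a b)"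
    by (simp add: form_act_expand[OF x GL_simps(1)[OF A] f, of ?u ?v] act_def)
  also have "(\<Sum>e\<in>Basis. \<Sum>e'\<in>Basis.
        crd e ?u * (crd e' ?v * f (C (x e e')) + (- crd e' ?Dv) * f (A (x e e')))
      + (- crd e ?Du) * (crd e' ?v * f (A (x e e')))) =
      f (C (x ?u ?v)) - f (A (x ?Du ?v)) - f (A (x ?u ?Dv))"
    unfolding form_act_expand[OF x GL_simps(1)[OF A] f, of ?Du ?v]
      form_act_expand[OF x GL_simps(1)[OF A] f, of ?u ?Dv] form_act_expand[OF x C f, of ?u ?v]
      sum_subtractf[symmetric]
    by (intro sum.cong refl) (simp add: algebra_simps)
  finally have "jet (\<lambda>g. f (act g x a b)) A C (f (act A x a b)) (f (orbit_velocity x A C a b))"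
    by (subst jet_cong) (auto simp: act_def form_act_expand[OF x GL_simps(1) f]
        orbit_velocity_def form_simps[OF f])
  then have "jet (\<lambda>g. (\<lambda>y. if y \<in> C2 s then f (y a b) else 0) (act g x)) A C
      (f (act A x a b)) (f (orbit_velocity x A C a b))"
    by (subst jet_cong[of _ "\<lambda>g. f (act g x a b)"]) (auto simp: act_C2 x)
  then show "jet (\<lambda>g. (\<lambda>y. if y \<in> C2 s then f (y a b) else 0) (act g x)) A C
      ((\<lambda>y. if y \<in> C2 s then f (y a b) else 0) (act A x))
      (dif (\<lambda>y. if y \<in> C2 s then f (y a b) else 0) (act A x) (orbit_velocity x A C))"
    by (subst dif_coord[OF D f]) (simp add: D)
next
  note D = act_C2[OF A x] orbit_velocity_C2[OF x A C]
  fix p q assume p: "p \<in> coord_ring s" and q: "q \<in> coord_ring s"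
    and IH: "jet (\<lambda>g. p (act g x)) A C (p (act A x)) (dif p (act A x) (orbit_velocity x A C))"
      "jet (\<lambda>g. q (act g x)) A C (q (act A x)) (dif q (act A x) (orbit_velocity x A C))"
  show "jet (\<lambda>g. (p + q) (act g x)) A C ((p + q) (act A x))
      (dif (p + q) (act A x) (orbit_velocity x A C))"
    using jet_add[OF IH] by (simp add: dif_add D p q)
  show "jet (\<lambda>g. (p * q) (act g x)) A C ((p * q) (act A x))
      (dif (p * q) (act A x) (orbit_velocity x A C))"
    using jet_mult[OF IH] by (simp add: dif_mult D p q)
qed

lemma regular_act: "x \<in> C2 s \<Longrightarrow> p \<in> coord_ring s \<Longrightarrow> regular (\<lambda>g. p (act g x))"
  unfolding regular_def using jet_act by blast

lemma delta1_C2: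
  "x \<in> C2 s \<Longrightarrow> Vector_Spaces.linear s s f \<Longrightarrow> delta1 x f \<in> C2 s"
  unfolding C2_iff delta1_def
  by (simp add: C2_simps endo_simps scale_right_diff_distrib scale_right_distrib)

lemma vanishing_ideal_orbit_subset:
  "vanishing_ideal s (orbit s x) \<subseteq> max_ideal s x"
  using id_GL act_id[of x] by (fastforce simp: vanishing_ideal_def max_ideal_def orbit_def)

lemma B2_annihilates_orbit_ideal:
  assumes x: "x \<in> C2 s" and \<phi>: "\<phi> \<in> B2 s x" and p: "p \<in> vanishing_ideal s (orbit s x)"
  shows "tangent_vector s x \<phi> p = 0"
proof -
  obtain f where f: "Vector_Spaces.linear s s f" "\<phi> = delta1 x f"
    using \<phi> by (auto simp: B2_def C1_def)
  have pc: "p \<in> coord_ring s" and pv: "\<And>g. g \<in> GL s \<Longrightarrow> p (act g x) = 0"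
    using p by (auto simp: vanishing_ideal_def orbit_def)
  have "dif p (act id x) (orbit_velocity x id f) = 0"
    by (rule jet_vanishing[OF id_GL f(1) jet_act[OF x id_GL f(1) pc] pv])
  \<comment> \<open>The action moves the arguments by the inverse of g, whence the sign.\<close>
  moreover have "orbit_velocity x id f = smult2 s (-1) \<phi>"
    by (auto simp: orbit_velocity_def smult2_def fun_eq_iff f(2) delta1_def)
  ultimately have "dif p x \<phi> = 0"
    using dif_smult_right[OF pc x delta1_C2[OF x f(1)], of "-1"] by (simp add: act_id f(2))
  then show ?thesis by (simp add: tangent_vector_eq)
qed

subsection \<open>The tangent space of the orbit\<close>

text \<open>
  Regular functions on the general linear group that vanish in the residue field of \<open>M\<close> vanish
  identically, so that this field plays the role of the function field of the group.
\<close>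
lemma generic_maximal_ideal:
  obtains M :: "(('v \<Rightarrow> 'v) \<Rightarrow> 'k) set" where "residue_field_char_0 M"
    "\<And>r g. r \<in> M \<Longrightarrow> regular r \<Longrightarrow> g \<in> GL s \<Longrightarrow> r g = 0"
proof -
  \<comment> \<open>The functions that vanish generically: some nonzero regular function annihilates
    them on the group. Irreducibility makes J closed under addition.\<close>
  define J where "J = {r. \<exists>h. regular h \<and> (\<exists>g\<in>GL s. h g \<noteq> 0) \<and> (\<forall>g\<in>GL s. r g * h g = (0 :: 'k))}"
  have JI: "r \<in> J" if "regular h" "g \<in> GL s" "h g \<noteq> 0" "\<And>g. g \<in> GL s \<Longrightarrow> r g * h g = 0" for r h g
    using that unfolding J_def by blast
  have JE: "\<exists>h g. regular h \<and> g \<in> GL s \<and> h g \<noteq> 0 \<and> (\<forall>g\<in>GL s. r g * h g = 0)" if "r \<in> J" for r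
    using that unfolding J_def by blast
  have "proper_ideal J"
    unfolding proper_ideal_def
  proof (intro conjI ballI allI)
    show "0 \<in> J" by (rule JI[OF regular_const id_GL, of 1]) auto
    show "1 \<notin> J" using JE[of 1] by auto
    fix a assume "a \<in> J"
    then obtain h g where h: "regular h" "g \<in> GL s" "h g \<noteq> 0" "\<forall>g\<in>GL s. a g * h g = 0"
      using JE by blast
    show "r * a \<in> J" for r
      by (rule JI[OF h(1-3)]) (use h(4) in auto)
    fix b assume "b \<in> J"
    then obtain h' g' where h': "regular h'" "g' \<in> GL s" "h' g' \<noteq> 0" "\<forall>g\<in>GL s. b g * h' g = 0"
      using JE by blast
    obtain g'' where g'': "g'' \<in> GL s" "h g'' * h' g'' \<noteq> 0"
      using regular_common_nonzero[OF h(1) h'(1) h(2,3) h'(2,3)] by blast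
    have ring_identity: "(u + v) * (p * q) = (u * p) * q + (v * q) * p" for u v p q :: 'k
      by (simp add: algebra_simps)
    have "(a + b) g * (h g * h' g) = 0" if "g \<in> GL s" for g
    proof -
      have "(a + b) g * (h g * h' g) = (a g * h g) * h' g + (b g * h' g) * h g"
        unfolding plus_fun_apply by (rule ring_identity)
      then show ?thesis using h(4)[rule_format, OF that] h'(4)[rule_format, OF that] by simp
    qed
    then show "a + b \<in> J"
      using regular_mult[OF h(1) h'(1)] g'' unfolding J_def by blast
  qed
  then obtain M where M: "proper_ideal M" "J \<subseteq> M" and inv: "\<And>a. a \<notin> M \<Longrightarrow> \<exists>b. b * a - 1 \<in> M"
    by (rule maximal_ideal_exists) (rule that)
  have unit: False if r: "r \<in> M" "\<And>g. r g \<noteq> 0" for r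
  proof -
    have "(\<lambda>g. inverse (r g)) * r = 1" using r(2) by (auto simp: fun_eq_iff)
    then show False using proper_idealD(2)[OF M(1)] proper_idealD(4)[OF M(1) r(1)] by metis
  qed
  have "residue_field_char_0 M"
  proof
    show "of_nat n \<notin> M" if "n > 0" for n using unit[of "of_nat n"] that by auto
  qed (fact M(1), fact inv)
  moreover have "r g = 0" if r: "r \<in> M" "regular r" "g \<in> GL s" for r g
  proof (rule ccontr)
    assume g: "r g \<noteq> 0"
    \<comment> \<open>The indicator of the zeros of r. It is annihilated by r itself, hence lies in
      J, while r plus this indicator vanishes nowhere.\<close>
    let ?r' = "\<lambda>g. if r g = 0 then 1 else 0 :: 'k"
    have "?r' \<in> J" by (rule JI[OF r(2,3) g]) auto
    then have "?r' + r \<in> M" using M(2) r(1) by (intro proper_idealD(3)[OF M(1)]) blast+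
    then show False by (rule unit) auto
  qed
  ultimately show thesis by (rule that)
qed

lemma coord_ring_act:
  assumes g: "g \<in> GL s" and p: "p \<in> coord_ring s"
  shows "(\<lambda>y. p (act g y)) \<in> coord_ring s"
  using p
proof induction
  show "(\<lambda>y. cfun c (act g y)) \<in> coord_ring s" for c
    using coord_ring.const[of s c] by (simp add: act_C2_iff[OF g])
next
  fix f a b assume f: "Vector_Spaces.linear s (*) f"
  then have "Vector_Spaces.linear s (*) (\<lambda>v. f (g v))"
    by (simp add: form_iff endo_simps[OF GL_simps(1)[OF g]])
  from coord_ring.coord[OF this, of "inv g a" "inv g b"]
  have "(\<lambda>y. if y \<in> C2 s then f (act g y a b) else 0) \<in> coord_ring s"
    unfolding act_def .
  then show "(\<lambda>y. (\<lambda>y. if y \<in> C2 s then f (y a b) else 0) (act g y)) \<in> coord_ring s"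
    by (simp only: act_C2_iff[OF g])
next
  fix p q
  assume IH: "(\<lambda>y. p (act g y)) \<in> coord_ring s" "(\<lambda>y. q (act g y)) \<in> coord_ring s"
  have "(\<lambda>y. (p + q) (act g y)) = (\<lambda>y. p (act g y)) + (\<lambda>y. q (act g y))"
    "(\<lambda>y. (p * q) (act g y)) = (\<lambda>y. p (act g y)) * (\<lambda>y. q (act g y))"
    by (simp_all add: fun_eq_iff)
  then show "(\<lambda>y. (p + q) (act g y)) \<in> coord_ring s" "(\<lambda>y. (p * q) (act g y)) \<in> coord_ring s"
    using coord_ring.add[OF IH] coord_ring.mult[OF IH] by simp_all
qed

lemma dif_act: "g \<in> GL s \<Longrightarrow> dif (\<lambda>y. p (act g y)) x \<phi> = dif p (act g x) (act g \<phi>)"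
  by (simp add: dif_def line_poly_def act_line)

text \<open>The orbit is stable under g, so p composed with the action of g again vanishes on it and
  is killed by \<phi>; the action is linear in the product, which turns this into a derivative of p
  at g . x.\<close>

lemma orbit_tangent_translate:
  assumes \<phi>: "\<forall>p\<in>vanishing_ideal s (orbit s x). tangent_vector s x \<phi> p = 0"
    and p: "p \<in> vanishing_ideal s (orbit s x)" and g: "g \<in> GL s"
  shows "dif p (act g x) (act g \<phi>) = 0"
proof -
  have pc: "p \<in> coord_ring s" and p0: "p (act h x) = 0" if "h \<in> GL s" for h
    using p that by (auto simp: vanishing_ideal_def orbit_def)
  have "p (act g (act h x)) = 0" if "h \<in> GL s" for h
    using p0[OF GL_comp[OF g that]] by (simp add: act_comp[OF g that])
  then have "(\<lambda>y. p (act g y)) \<in> vanishing_ideal s (orbit s x)"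
    using coord_ring_act[OF g pc[OF g]] by (auto simp: vanishing_ideal_def orbit_def)
  then have "tangent_vector s x \<phi> (\<lambda>y. p (act g y)) = 0"
    "(\<lambda>y. p (act g y)) \<in> max_ideal s x"
    using \<phi> vanishing_ideal_orbit_subset by auto
  then show ?thesis by (simp add: tangent_vector_eq dif_act[OF g])
qed

text \<open>
  The derivation \<open>p(g \<cdot> x) \<mapsto> d p (g \<cdot> \<phi>)\<close>, defined on the functions coming from the orbit, extends to
  all functions of \<open>g\<close>. Applying the extension to the identity \<open>(g \<cdot> x)(g a, g b) = g (x(a, b))\<close>
  exhibits \<open>g \<cdot> \<phi>\<close> as a coboundary for the product \<open>g \<cdot> x\<close>.
\<close>
lemma orbit_annihilator_B2:
  assumes x: "x \<in> C2 s" and \<phi>: "\<phi> \<in> C2 s"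
    and ann: "\<forall>p\<in>vanishing_ideal s (orbit s x). tangent_vector s x \<phi> p = 0"
  shows "\<phi> \<in> B2 s x"
proof -
  obtain M :: "(('v \<Rightarrow> 'v) \<Rightarrow> 'k) set" where "residue_field_char_0 M"
    and generic: "\<And>r g. r \<in> M \<Longrightarrow> regular r \<Longrightarrow> g \<in> GL s \<Longrightarrow> r g = 0"
    by (rule generic_maximal_ideal) (rule that)
  interpret residue_field_char_0 M by fact
  \<comment> \<open>M is an ideal of functions of all self-maps of V; non-invertible arguments are
    sent to the identity to keep everything below defined and bilinear.\<close>
  define G where "G g = (if g \<in> GL s then g else id)" for g
  have G: "G g \<in> GL s" for g by (simp add: G_def id_GL)
  define y where "y g = act (G g) x" for g
  define w where "w g = act (G g) \<phi>" for g
  have yw: "y g \<in> C2 s" "w g \<in> C2 s" for g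
    unfolding y_def w_def by (intro act_C2 G x \<phi>)+
  \<comment> \<open>Coefficients of degree 2 and more are left free, as only dual numbers
    matter.\<close>
  define D where "D = {q. \<exists>p\<in>coord_ring s. coeff q 0 = (\<lambda>g. p (y g)) \<and> coeff q 1 = (\<lambda>g. dif p (y g) (w g))}"
  have DI: "q \<in> D" if "p \<in> coord_ring s" "\<And>g. coeff q 0 g = p (y g)"
    "\<And>g. coeff q 1 g = dif p (y g) (w g)" for p q
    using that unfolding D_def by (intro CollectI bexI[of _ p]) (auto simp: fun_eq_iff)
  have DE: "\<exists>p\<in>coord_ring s. (\<forall>g. coeff q 0 g = p (y g)) \<and> (\<forall>g. coeff q 1 g = dif p (y g) (w g))"
    if "q \<in> D" for q
    using that unfolding D_def by (auto simp: fun_eq_iff)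
  have "derivation_graph D"
    unfolding derivation_graph_def subring_def
  proof (intro conjI ballI impI)
    show "1 \<in> D"
      by (rule DI[OF coord_ring.const[of s 1]]) (simp_all add: yw dif_const coeff_1)
    fix a assume "a \<in> D"
    then obtain p where p: "p \<in> coord_ring s" "\<And>g. coeff a 0 g = p (y g)"
      "\<And>g. coeff a 1 g = dif p (y g) (w g)" using DE by blast
    show "- a \<in> D"
    proof (rule DI[OF coord_ring_uminus[OF p(1)]])
      show "coeff (- a) 1 g = dif (- p) (y g) (w g)" for g
        using dif_diff[OF yw[of g] coord_ring_0 p(1)] p(3)[of g] by (simp add: dif_0[OF yw[of g]])
    qed (simp add: p)
    \<comment> \<open>Well-definedness: if p(g . x) is zero in the residue field, it is zero on the
      whole group, so p lies in the ideal of the orbit.\<close>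
    show "coeff a 1 \<in> M" if "coeff a 0 \<in> M"
    proof -
      have "regular (coeff a 0)"
        using regular_act[OF x p(1)]
        by (subst regular_cong[of _ "\<lambda>g. p (act g x)"]) (simp_all add: p(2) y_def G_def)
      from generic[OF that this] have "p (act g x) = 0" if "g \<in> GL s" for g
        using p(2)[of g] that by (simp add: y_def G_def)
      then have "p \<in> vanishing_ideal s (orbit s x)"
        using p(1) by (auto simp: vanishing_ideal_def orbit_def)
      from orbit_tangent_translate[OF ann this G] have "coeff a 1 g = 0" for g
        using p(3)[of g] by (simp add: y_def w_def)
      then have "coeff a 1 = 0" by (simp add: fun_eq_iff)
      then show ?thesis using proper_idealD(1)[OF ideal] by metis
    qed
    fix b assume "b \<in> D"
    then obtain q where q: "q \<in> coord_ring s" "\<And>g. coeff b 0 g = q (y g)"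
      "\<And>g. coeff b 1 g = dif q (y g) (w g)" using DE by blast
    show "a + b \<in> D"
      using p q by (intro DI[OF coord_ring.add[OF p(1) q(1)]]) (simp_all add: dif_add yw)
    show "a * b \<in> D"
    proof (rule DI[OF coord_ring.mult[OF p(1) q(1)]])
      show "coeff (a * b) 0 g = (p * q) (y g)" for g by (simp add: coeff_mult_0 p q)
      show "coeff (a * b) 1 g = dif (p * q) (y g) (w g)" for g
        using p q by (simp only: coeff_mult_1 dif_mult yw) simp
    qed
  qed
  then obtain E where E: "derivation_graph E" "D \<subseteq> E" and total: "\<And>z. \<exists>\<zeta>. [:z, \<zeta>:] \<in> E"
    by (rule derivation_extension) (rule that)
  have sE: "subring E" using E(1) by (simp add: derivation_graph_def)
  define z where "z i j = (\<lambda>g. crd i (G g j))" for i j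
  \<comment> \<open>Values of the extended derivation on the matrix entries of g; F below is the
    resulting derivative of g.\<close>
  define Z where "Z i j = (SOME \<zeta>. [:z i j, \<zeta>:] \<in> E)" for i j
  have Z: "[:z i j, Z i j:] \<in> E" for i j
    unfolding Z_def by (rule someI_ex[OF total])
  define F where "F g v = (\<Sum>j\<in>Basis. s (crd j v) (\<Sum>i\<in>Basis. s (Z i j g) i))" for g v
  have F_lin: "Vector_Spaces.linear s s (F g)" for g
    unfolding F_def by (rule endo_on_Basis(1))
  have crd_F: "crd i (F g j) = Z i j g" if "i \<in> Basis" "j \<in> Basis" for i j g
    unfolding F_def endo_on_Basis(2)[OF that(2)] by (rule crd_sum[OF that(1)])
  let ?yk = "\<lambda>k i j. [:\<lambda>g. crd k (y g i j), \<lambda>g. crd k (w g i j):]"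
  have yk: "?yk k i j \<in> E" for k i j
    by (rule subsetD[OF E(2)], rule DI[OF coord_ring.coord[OF form_crd[of k], of i j]])
      (simp_all add: yw dif_coord[OF yw form_crd])
  have cE: "[:\<lambda>g. c, 0:] \<in> E" for c
    by (rule subsetD[OF E(2)], rule DI[OF coord_ring.const[of s c]]) (simp_all add: yw dif_const[OF yw])
  define r where "r k a b g = crd k (w g (G g a) (G g b) + y g (F g a) (G g b) + y g (G g a) (F g b)
    - F g (x a b))" for k a b g
  have rM: "r k a b \<in> M" if k: "k \<in> Basis" and a: "a \<in> Basis" and b: "b \<in> Basis" for k a b
  proof -
    \<comment> \<open>The identity (g . x)(g a, g b) = g (x(a, b)), read in the k-th coordinate with
      dual numbers as entries. Its constant term is exactly 0, and coefficient 1 is its derivative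
      \<open>r k a b\<close>.\<close>
    define q where "q = (\<Sum>i\<in>Basis. \<Sum>j\<in>Basis. [:z i a, Z i a:] * ([:z j b, Z j b:] * ?yk k i j))
      - (\<Sum>i\<in>Basis. [:\<lambda>g. crd i (x a b), 0:] * [:z k i, Z k i:])"
    have "q \<in> E"
      unfolding q_def
      by (intro subringD(5,6)[OF sE] subring_sum[OF sE] Z yk cE)
    moreover have "coeff q 0 = 0"
    proof
      fix g
      have "coeff q 0 g = (\<Sum>i\<in>Basis. \<Sum>j\<in>Basis. z i a g * (z j b g * crd k (y g i j)))
          - (\<Sum>i\<in>Basis. crd i (x a b) * z k i g)"
        unfolding q_def coeff_diff coeff_sum coeff_mult_0 coeff_pCons_0 by (simp add: sum_fun_apply)
      also have "(\<Sum>i\<in>Basis. crd i (x a b) * z k i g) = crd k (G g (x a b))"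
        unfolding z_def endo_expand[OF GL_simps(1)[OF G], of g "x a b"] by (simp add: form_simps[OF form_crd])
      also have "(\<Sum>i\<in>Basis. \<Sum>j\<in>Basis. z i a g * (z j b g * crd k (y g i j))) =
          crd k (y g (G g a) (G g b))"
        unfolding z_def C2_expand[OF yw(1), of g "G g a" "G g b"]
        by (simp add: form_simps[OF form_crd] mult.assoc)
      also have "y g (G g a) (G g b) = G g (x a b)"
        by (simp add: y_def act_def GL_simps(4)[OF G])
      finally show "coeff q 0 g = 0 g" by simp
    qed
    ultimately have "coeff q 1 \<in> M"
      using E(1) proper_idealD(1)[OF ideal] unfolding derivation_graph_def by auto
    also have "coeff q 1 = r k a b"
    proof
      fix g
      have "coeff q 1 g = (\<Sum>i\<in>Basis. \<Sum>j\<in>Basis. z i a g * (z j b g * crd k (w g i j) + Z j b g * crd k (y g i j))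
           + Z i a g * (z j b g * crd k (y g i j))) - (\<Sum>i\<in>Basis. crd i (x a b) * Z k i g)"
        unfolding q_def coeff_diff coeff_sum coeff_mult_0 coeff_mult_1 coeff_pCons_0
        by (simp add: sum_fun_apply)
      also have "(\<Sum>i\<in>Basis. crd i (x a b) * Z k i g) = crd k (F g (x a b))"
        by (subst endo_expand[OF F_lin]) (simp add: form_simps[OF form_crd] crd_F k)
      also have "(\<Sum>i\<in>Basis. \<Sum>j\<in>Basis. z i a g * (z j b g * crd k (w g i j) + Z j b g * crd k (y g i j))
           + Z i a g * (z j b g * crd k (y g i j))) =
          crd k (w g (G g a) (G g b)) + crd k (y g (G g a) (F g b)) + crd k (y g (F g a) (G g b))"
        unfolding C2_expand[OF yw(1), of g "G g a" "F g b"] C2_expand[OF yw(1), of g "F g a" "G g b"]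
          C2_expand[OF yw(2), of g "G g a" "G g b"]
        by (simp add: form_simps[OF form_crd] crd_F a b z_def algebra_simps sum.distrib)
      finally show "coeff q 1 g = r k a b g"
        by (simp add: r_def form_simps[OF form_crd])
    qed
    finally show ?thesis .
  qed
  \<comment> \<open>Finitely many coordinates suffice for the differentiated identity, so it holds
    exactly at some g.\<close>
  let ?R = "(\<lambda>(k, a, b). r k a b) ` (Basis \<times> Basis \<times> Basis)"
  have "finite ?R" "?R \<subseteq> M" using finite_Basis rM by auto
  from proper_ideal_common_zero[OF ideal this]
  obtain g where g: "\<And>f. f \<in> ?R \<Longrightarrow> f g = 0" by blast
  have rg: "r k a b g = 0" if "k \<in> Basis" "a \<in> Basis" "b \<in> Basis" for k a b
    using g[of "r k a b"] that by (force intro!: image_eqI[of _ _ "(k, a, b)"])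
  \<comment> \<open>Applying the inverse of g to the differentiated identity gives \<phi> +
    delta(g^-1 F) = 0, whence the sign.\<close>
  define f where "f v = - inv (G g) (F g v)" for v
  note lG = endo_simps[OF GL_simps(1)[OF G]] and lI = endo_simps[OF GL_simps(5)[OF G]]
    and lF = endo_simps[OF F_lin]
  have f: "Vector_Spaces.linear s s f"
    by (simp add: endo_iff f_def lI lF)
  have "\<phi> = delta1 x f"
  proof (rule C2_eq_by_Basis[OF \<phi> delta1_C2[OF x f]])
    fix a b assume ab: "a \<in> Basis" "b \<in> Basis"
    let ?v = "w g (G g a) (G g b) + y g (F g a) (G g b) + y g (G g a) (F g b) - F g (x a b)"
    have "?v = 0"
      by (rule eq_by_crd) (use rg ab in \<open>simp add: r_def form_simps[OF form_crd]\<close>)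
    then have "inv (G g) ?v = 0" by (simp only: lI)
    moreover have "inv (G g) ?v = \<phi> a b + x (inv (G g) (F g a)) b + x a (inv (G g) (F g b))
        - inv (G g) (F g (x a b))"
      by (simp add: lI w_def y_def act_def GL_simps(4)[OF G])
    ultimately show "\<phi> a b = delta1 x f a b"
      by (simp add: delta1_def f_def C2_simps[OF x] algebra_simps add_eq_0_iff)
  qed
  then show ?thesis using f by (auto simp: B2_def C1_def)
qed

lemma T_orbit_eq:
  assumes x: "x \<in> C2 s"
  shows "T_orbit s x = tangent_vector s x ` B2 s x"
proof -
  have "B2 s x \<subseteq> C2 s" using delta1_C2[OF x] by (auto simp: B2_def C1_def)
  then have "{\<phi> \<in> C2 s. \<forall>p\<in>vanishing_ideal s (orbit s x). tangent_vector s x \<phi> p = 0} = B2 s x"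
    using orbit_annihilator_B2[OF x] B2_annihilates_orbit_ideal[OF x] by blast
  then show ?thesis
    unfolding T_orbit_def zariski_tangent_eq[OF x] by simp
qed

end

subsection \<open>Quotients\<close>

lemma vsp_iso_subsp:
  assumes "inj_on T Z" "\<And>u w. u \<in> Z \<Longrightarrow> w \<in> Z \<Longrightarrow> T (u + w) = T u + T w"
    "\<And>c u. u \<in> Z \<Longrightarrow> T (sm c u) = sm' c (T u)"
  shows "vsp_iso T (subsp sm Z) (subsp sm' (T ` Z))"
  using assms by (auto simp: vsp_iso_def subsp_def bij_betw_def)

text \<open>Cosets are subsets of Z, and taking images under a map injective on Z is injective on
  subsets of Z, so no representatives have to be chosen.\<close>

lemma vsp_iso_quotsp:
  fixes T :: "'a::ab_group_add \<Rightarrow> 'b::ab_group_add"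
  assumes inj: "inj_on T Z" and add: "\<And>u w. u \<in> Z \<Longrightarrow> w \<in> Z \<Longrightarrow> T (u + w) = T u + T w"
    and scale: "\<And>c u. u \<in> Z \<Longrightarrow> T (sm c u) = sm' c (T u)"
    and Z: "\<And>u w. u \<in> Z \<Longrightarrow> w \<in> Z \<Longrightarrow> u + w \<in> Z" "\<And>c u. u \<in> Z \<Longrightarrow> sm c u \<in> Z"
    and B: "B \<subseteq> Z"
  shows "vsp_iso (\<lambda>X. T ` X) (quotsp sm Z B) (quotsp sm' (T ` Z) (T ` B))"
proof -
  have coset: "T ` {u + b | b. b \<in> B} = {T u + b' | b'. b' \<in> T ` B}" if "u \<in> Z" for u
  proof -
    have "T ` {u + b | b. b \<in> B} = (\<lambda>b. T (u + b)) ` B" by blast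
    also have "\<dots> = (\<lambda>b. T u + T b) ` B" using B add that by (intro image_cong) auto
    finally show ?thesis by blast
  qed
  have carrier: "vcarrier (quotsp sm Z B) \<subseteq> Pow Z"
    using B Z(1) by (auto simp: quotsp_def)
  have "(\<lambda>X. T ` X) ` vcarrier (quotsp sm Z B) = (\<lambda>u. T ` {u + b | b. b \<in> B}) ` Z"
    by (auto simp: quotsp_def)
  also have "\<dots> = (\<lambda>u. {T u + b' | b'. b' \<in> T ` B}) ` Z"
    using coset by (rule image_cong[OF refl])
  also have "\<dots> = vcarrier (quotsp sm' (T ` Z) (T ` B))"
    by (auto simp: quotsp_def)
  finally have "bij_betw (\<lambda>X. T ` X) (vcarrier (quotsp sm Z B)) (vcarrier (quotsp sm' (T ` Z) (T ` B)))"
    using inj_on_subset[OF inj_on_image_Pow[OF inj] carrier] by (simp add: bij_betw_def)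
  moreover have "T ` vadd (quotsp sm Z B) X Y = vadd (quotsp sm' (T ` Z) (T ` B)) (T ` X) (T ` Y)"
    if "X \<in> vcarrier (quotsp sm Z B)" "Y \<in> vcarrier (quotsp sm Z B)" for X Y
  proof -
    have "X \<subseteq> Z" "Y \<subseteq> Z" using carrier that by blast+
    have "T ` {u + w | u w. u \<in> X \<and> w \<in> Y} = (\<lambda>(u, w). T (u + w)) ` (X \<times> Y)"
      by (auto simp: image_iff)
    also have "\<dots> = (\<lambda>(u, w). T u + T w) ` (X \<times> Y)"
      using \<open>X \<subseteq> Z\<close> \<open>Y \<subseteq> Z\<close> add by (intro image_cong refl) auto
    also have "\<dots> = {u + w | u w. u \<in> T ` X \<and> w \<in> T ` Y}" by auto
    finally show ?thesis by (simp add: quotsp_def)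
  qed
  moreover have "T ` vsmult (quotsp sm Z B) c X = vsmult (quotsp sm' (T ` Z) (T ` B)) c (T ` X)"
    if "X \<in> vcarrier (quotsp sm Z B)" for c X
  proof -
    have "X \<subseteq> Z" using carrier that by blast
    have "T ` {sm c u + b | u b. u \<in> X \<and> b \<in> B} = (\<lambda>(u, b). T (sm c u + b)) ` (X \<times> B)"
      by (auto simp: image_iff)
    also have "\<dots> = (\<lambda>(u, b). sm' c (T u) + T b) ` (X \<times> B)"
    proof (intro image_cong refl, clarify)
      fix u b assume "u \<in> X" "b \<in> B"
      then have "u \<in> Z" "b \<in> Z" using \<open>X \<subseteq> Z\<close> B by blast+
      then show "T (sm c u + b) = sm' c (T u) + T b" by (simp add: add scale Z(2))
    qed
    also have "\<dots> = {sm' c u + b | u b. u \<in> T ` X \<and> b \<in> T ` B}" by auto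
    finally show ?thesis by (simp add: quotsp_def)
  qed
  ultimately show ?thesis by (simp add: vsp_iso_def)
qed

section \<open>Coboundaries as cocycles, and the isomorphisms\<close>

context fin_dim_space
begin

lemma Z2_add: "x \<in> C2 s \<Longrightarrow> \<phi> \<in> Z2 s x \<Longrightarrow> \<psi> \<in> Z2 s x \<Longrightarrow> \<phi> + \<psi> \<in> Z2 s x"
proof -
  assume x: "x \<in> C2 s" and \<phi>: "\<phi> \<in> Z2 s x" and \<psi>: "\<psi> \<in> Z2 s x"
  have "delta2 x (\<phi> + \<psi>) a b c = delta2 x \<phi> a b c + delta2 x \<psi> a b c" for a b c
    by (simp add: delta2_def C2_simps[OF x])
  then show ?thesis using \<phi> \<psi> by (simp add: Z2_def C2_add fun_eq_iff)
qed

lemma Z2_smult: "x \<in> C2 s \<Longrightarrow> \<phi> \<in> Z2 s x \<Longrightarrow> smult2 s c \<phi> \<in> Z2 s x"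
proof -
  assume x: "x \<in> C2 s" and \<phi>: "\<phi> \<in> Z2 s x"
  have "delta2 x (smult2 s c \<phi>) a b d = s c (delta2 x \<phi> a b d)" for a b d
    by (simp add: delta2_def smult2_def C2_simps[OF x] scale_right_diff_distrib scale_right_distrib)
  then show ?thesis using \<phi> by (simp add: Z2_def C2_smult fun_eq_iff)
qed

text \<open>The infinitesimal form of the equivariance of F under GL(V): on a coboundary, delta2 is
  the change of the trilinear map F(x) along f, which is zero when F(x) is.\<close>

lemma B2_subset_Z2:
  assumes "x \<in> Leib s"
  shows "B2 s x \<subseteq> Z2 s x"
proof
  have x: "x \<in> C2 s" and L: "leibniz_F x a b c = 0" for a b c
    using assms by (auto simp: Leib_def)
  fix \<phi> assume "\<phi> \<in> B2 s x"
  then obtain f where f: "Vector_Spaces.linear s s f" and \<phi>: "\<phi> = delta1 x f"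
    by (auto simp: B2_def C1_def)
  have "delta2 x \<phi> a b c = leibniz_F x (f a) b c + leibniz_F x a (f b) c + leibniz_F x a b (f c)
      - f (leibniz_F x a b c)" for a b c
    unfolding \<phi> delta2_def delta1_def leibniz_F_def
    by (simp add: C2_simps[OF x] endo_simps[OF f])
  then have "delta2 x \<phi> = (\<lambda>a b c. 0)" by (intro ext) (simp add: L endo_simps[OF f])
  then show "\<phi> \<in> Z2 s x" using delta1_C2[OF x f] by (simp add: Z2_def \<phi>)
qed

end

theorem proposition2p4:
  fixes s :: "'k::field_char_0 \<Rightarrow> 'v::ab_group_add \<Rightarrow> 'v"
    and Basis :: "'v set"
    and n :: nat
    and x :: "'v \<Rightarrow> 'v \<Rightarrow> 'v"
  assumes "finite_dimensional_vector_space s Basis"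
    and "vector_space.dim s (UNIV :: 'v set) = n"
    and "x \<in> Leib s"
  shows "vsp_iso (tangent_vector s x) (subsp (smult2 s) (Z2 s x)) (subsp smult_form (T_Leib s x))
    \<and> B2 s x \<subseteq> Z2 s x \<and> T_orbit s x \<subseteq> T_Leib s x
    \<and> vsp_iso (tangent_vector s x) (subsp (smult2 s) (B2 s x)) (subsp smult_form (T_orbit s x))
    \<and> vsp_iso (\<lambda>X. tangent_vector s x ` X) (H2 s x) (T_stack s x)"
proof -
  interpret fin_dim_space s Basis by (rule fin_dim_space.intro[OF assms(1)])
  have x: "x \<in> C2 s" using assms(3) by (simp add: Leib_def)
  have BZ: "B2 s x \<subseteq> Z2 s x" by (rule B2_subset_Z2[OF assms(3)])
  have ZC: "Z2 s x \<subseteq> C2 s" by (auto simp: Z2_def)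
  note injZ = inj_on_subset[OF tangent_vector_inj[OF x] ZC]
  have add: "tangent_vector s x (\<phi> + \<psi>) = tangent_vector s x \<phi> + tangent_vector s x \<psi>"
    if "\<phi> \<in> Z2 s x" "\<psi> \<in> Z2 s x" for \<phi> \<psi>
    using that ZC by (intro tangent_vector_add[OF x]) auto
  have scale: "tangent_vector s x (smult2 s c \<phi>) = smult_form c (tangent_vector s x \<phi>)"
    if "\<phi> \<in> Z2 s x" for c \<phi>
    using that ZC by (intro tangent_vector_smult[OF x]) auto
  note T = T_Leib_eq[OF assms(3)] T_orbit_eq[OF x]
  show ?thesis
    unfolding H2_def T_stack_def T
  proof (intro conjI BZ image_mono)
    show "vsp_iso (tangent_vector s x) (subsp (smult2 s) (Z2 s x))
        (subsp smult_form (tangent_vector s x ` Z2 s x))"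
      by (rule vsp_iso_subsp) (rule injZ add scale; assumption)+
    show "vsp_iso (tangent_vector s x) (subsp (smult2 s) (B2 s x))
        (subsp smult_form (tangent_vector s x ` B2 s x))"
      by (rule vsp_iso_subsp)
        (rule inj_on_subset[OF injZ BZ] add[OF subsetD[OF BZ] subsetD[OF BZ]]
          scale[OF subsetD[OF BZ]]; assumption)+
    show "vsp_iso (\<lambda>X. tangent_vector s x ` X) (quotsp (smult2 s) (Z2 s x) (B2 s x))
        (quotsp smult_form (tangent_vector s x ` Z2 s x) (tangent_vector s x ` B2 s x))"
      by (rule vsp_iso_quotsp) (rule injZ add scale Z2_add[OF x] Z2_smult[OF x] BZ; assumption)+
  qed
qed

end
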